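(* Let $\{N_r:r\in\Gamma\}$ be an uncountable maximal almost disjoint family of infinite subsets of $\omega$, and let $JL_2$ be the Johnson-Lindenstrauss space associated with it. Then $JL_2$ has weak*-sequential dual ball with sequential order $2$.
   Context: A family of infinite subsets of $\omega$ is almost disjoint if any two distinct members have finite intersection, and maximal almost disjoint if it is maximal under inclusion among almost disjoint families. Let $\chi_{N_r}\in\ell_\infty$ be the characteristic function of $N_r$. The Johnson-Lindenstrauss space $JL_2$ is the completion of $\operatorname{span}(c_0\cup\{\chi_{N_r}:r\in\Gamma\})\subset\ell_\infty$ with respect to the norm $$\Big\|x+\sum_{1\le i\le k}a_i\chi_{N_{r_i}}\Big\|=\max\Big\{\Big\|x+\sum_{1\le i\le k}a_i\chi_{N_{r_i}}\Big\|_\infty,\ \Big(\sum_{1\le i\le k}|a_i|^2\Big)^{1/2}\Big\},$$ where $x\in c_0$, $r_1,\dots,r_k\in\Gamma$ are distinct, $a_i$ are scalars, and $\|\cdot\|_\infty$ is the supremum norm of $\ell_\infty$. For a subset $F$ of a Hausdorff topological space $T$, the sequential closure of $F$ is the set of all limits (in $T$) of convergent sequences of elements of $F$; $F$ is sequentially closed if it equals its sequential closure; $T$ is sequential if every sequentially closed subset is closed. Define $S_0(F)=F$, $S_{\alpha+1}(F)$ the sequential closure of $S_\alpha(F)$, and $S_\alpha(F)=\bigcup_{\beta<\alpha}S_\beta(F)$ for limit $\alpha$. $T$ has sequential order $\alpha$ if $S_\alpha(F)=\overline F$ for every $F\subset T$ and for every $\beta<\alpha$ there is $F\subset T$ with $S_\beta(F)\ne\overline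 F$. A Banach space $X$ has weak*-sequential dual ball with sequential order $\alpha$ if the closed unit ball $B_{X^*}$ of $X^*$ with the weak* topology is sequential and has sequential order $\alpha$. *)

theory Defs
  imports "HOL-Analysis.Analysis"
begin

section \<open>Maximal almost disjoint families\<close>

definition almost_disjoint :: "nat set set \<Rightarrow> bool" where
  "almost_disjoint F \<longleftrightarrow>
     (\<forall>A\<in>F. infinite A) \<and> (\<forall>A\<in>F. \<forall>B\<in>F. A \<noteq> B \<longrightarrow> finite (A \<inter> B))"

definition maximal_almost_disjoint :: "nat set set \<Rightarrow> bool" where
  "maximal_almost_disjoint F \<longleftrightarrow>
     almost_disjoint F \<and> (\<forall>G. almost_disjoint G \<and> F \<subseteq> G \<longrightarrow> G = F)"

section \<open>Sequential spaces and sequential order\<close>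

definition seq_closure_of :: "'a topology \<Rightarrow> 'a set \<Rightarrow> 'a set" where
  "seq_closure_of T F =
     {l \<in> topspace T. \<exists>s::nat \<Rightarrow> 'a. (\<forall>n. s n \<in> F) \<and> limitin T s l sequentially}"

definition seq_closedin :: "'a topology \<Rightarrow> 'a set \<Rightarrow> bool" where
  "seq_closedin T F \<longleftrightarrow> F \<subseteq> topspace T \<and> seq_closure_of T F = F"

definition sequential_space :: "'a topology \<Rightarrow> bool" where
  "sequential_space T \<longleftrightarrow> (\<forall>F. seq_closedin T F \<longrightarrow> closedin T F)"

text \<open>The iterated sequential closures at finite stages. Whether a space has sequential order
  \<open>n\<close>, for a finite ordinal \<open>n\<close>, involves only the stages up to \<open>n\<close>, so no limit stage occurs.\<close>

primrec seq_closure_iter :: "'a topology \<Rightarrow> nat \<Rightarrow> 'a set \<Rightarrow> 'a set" where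
  "seq_closure_iter T 0 F = F"
| "seq_closure_iter T (Suc n) F = seq_closure_of T (seq_closure_iter T n F)"

definition has_sequential_order :: "'a topology \<Rightarrow> nat \<Rightarrow> bool" where
  "has_sequential_order T n \<longleftrightarrow>
     (\<forall>F\<subseteq>topspace T. seq_closure_iter T n F = T closure_of F) \<and>
     (\<forall>m<n. \<exists>F\<subseteq>topspace T. seq_closure_iter T m F \<noteq> T closure_of F)"

section \<open>Banach spaces over the scalar field and the weak-star topology of the dual ball\<close>

text \<open>The type class \<open>banach\<close> only provides real scalars. In order to treat real and complex scalars
  alike, the multiplication by scalars from \<open>'k\<close> is a parameter, compatible with the real one.
  For \<open>'k = real\<close> it is necessarily \<open>scaleR\<close>.\<close>

locale banach_space_over = vector_space smul
  for smul :: "'k::real_normed_field \<Rightarrow> 'x::banach \<Rightarrow> 'x" +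
  assumes smul_of_real: "smul (of_real t) x = t *\<^sub>R x"
    and norm_smul: "norm (smul c x) = norm c * norm x"

lemma banach_space_over_scaleR:
  "banach_space_over (scaleR :: real \<Rightarrow> 'x::banach \<Rightarrow> 'x)"
  by unfold_locales (auto simp: scaleR_add_right scaleR_add_left)

lemma banach_space_over_complex:
  "banach_space_over ((*) :: complex \<Rightarrow> complex \<Rightarrow> complex)"
  by unfold_locales (auto simp: algebra_simps scaleR_conv_of_real norm_mult)

text \<open>A functional that is linear over \<open>'k\<close> is in particular real-linear, and its norm as a
  functional is its operator norm as a real-linear map.\<close>

definition dual_ball :: "('k::real_normed_field \<Rightarrow> 'x::banach \<Rightarrow> 'x) \<Rightarrow> ('x \<Rightarrow>\<^sub>L 'k) set" where
  "dual_ball smul =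
     {f. (\<forall>c x. blinfun_apply f (smul c x) = c * blinfun_apply f x) \<and> norm f \<le> 1}"

text \<open>For scalar-valued operators the strong operator topology, that is the topology of pointwise
  convergence, is the weak-star topology.\<close>

definition weak_star_dual_ball ::
    "('k::real_normed_field \<Rightarrow> 'x::banach \<Rightarrow> 'x) \<Rightarrow> ('x \<Rightarrow>\<^sub>L 'k) topology" where
  "weak_star_dual_ball smul = subtopology strong_operator_topology (dual_ball smul)"

definition weak_star_sequential_dual_ball_of_order ::
    "('k::real_normed_field \<Rightarrow> 'x::banach \<Rightarrow> 'x) \<Rightarrow> nat \<Rightarrow> bool" where
  "weak_star_sequential_dual_ball_of_order smul n \<longleftrightarrow>
     sequential_space (weak_star_dual_ball smul) \<and>
     has_sequential_order (weak_star_dual_ball smul) n"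

section \<open>Johnson-Lindenstrauss spaces\<close>

text \<open>Since every function on \<open>nat\<close> is continuous, the type \<open>nat \<Rightarrow>\<^sub>C 'k\<close> with its norm is the space
  of bounded scalar sequences with the supremum norm.\<close>

definition scale_linf :: "'k::real_normed_field \<Rightarrow> (nat \<Rightarrow>\<^sub>C 'k) \<Rightarrow> (nat \<Rightarrow>\<^sub>C 'k)" where
  "scale_linf c f = Bcontfun (\<lambda>n. c * apply_bcontfun f n)"

definition char_seq :: "nat set \<Rightarrow> (nat \<Rightarrow>\<^sub>C 'k::real_normed_field)" where
  "char_seq A = Bcontfun (indicator A)"

lemma apply_scale_linf: "apply_bcontfun (scale_linf c f) n = c * apply_bcontfun f n"
proof -
  have "bounded ((\<lambda>y. c * y) ` range (apply_bcontfun f))"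
    by (intro bounded_linear_image bounded_linear_mult_right) simp
  then have "(\<lambda>n. c * apply_bcontfun f n) \<in> bcontfun"
    by (simp add: bcontfun_def image_image)
  then show ?thesis
    by (simp add: scale_linf_def Bcontfun_inverse)
qed

lemma apply_char_seq: "apply_bcontfun (char_seq A) n = indicator A n"
proof -
  have "bounded (range (indicator A :: nat \<Rightarrow> 'a))"
    by (rule boundedI[of _ 1]) (auto simp: indicator_def)
  then have "(indicator A :: nat \<Rightarrow> 'a) \<in> bcontfun"
    by (simp add: bcontfun_def)
  then show ?thesis
    by (simp add: char_seq_def Bcontfun_inverse)
qed

lemma vector_space_scale_linf:
  "vector_space (scale_linf :: 'k::real_normed_field \<Rightarrow> (nat \<Rightarrow>\<^sub>C 'k) \<Rightarrow> (nat \<Rightarrow>\<^sub>C 'k))"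
  by unfold_locales
    (auto intro!: bcontfun_eqI simp: apply_scale_linf plus_bcontfun.rep_eq algebra_simps)

definition c0_space :: "(nat \<Rightarrow>\<^sub>C 'k::real_normed_field) set" where
  "c0_space = {x. (\<lambda>n. apply_bcontfun x n) \<longlonglongrightarrow> 0}"

definition JL_span :: "('i \<Rightarrow> nat set) \<Rightarrow> 'i set \<Rightarrow> (nat \<Rightarrow>\<^sub>C 'k::real_normed_field) set" where
  "JL_span N \<Gamma> = module.span scale_linf (c0_space \<union> (\<lambda>r. char_seq (N r)) ` \<Gamma>)"

text \<open>The Banach space \<open>'x\<close> with scalar multiplication \<open>smul\<close> is a completion of \<open>JL_span N \<Gamma>\<close> with
  respect to the Johnson-Lindenstrauss norm, \<open>J\<close> being the canonical linear isometry onto a dense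
  subspace. Completeness of \<open>'x\<close> is part of the class \<open>banach\<close>. The values of \<open>J\<close> outside
  \<open>JL_span N \<Gamma>\<close> play no role.\<close>

definition is_JL2 ::
    "('i \<Rightarrow> nat set) \<Rightarrow> 'i set \<Rightarrow> ('k::real_normed_field \<Rightarrow> 'x::banach \<Rightarrow> 'x) \<Rightarrow>
     ((nat \<Rightarrow>\<^sub>C 'k) \<Rightarrow> 'x) \<Rightarrow> bool" where
  "is_JL2 N \<Gamma> smul J \<longleftrightarrow>
     banach_space_over smul \<and>
     (\<forall>f\<in>JL_span N \<Gamma>. \<forall>g\<in>JL_span N \<Gamma>. J (f + g) = J f + J g) \<and>
     (\<forall>c. \<forall>f\<in>JL_span N \<Gamma>. J (scale_linf c f) = smul c (J f)) \<and>
     (\<forall>x\<in>c0_space. \<forall>R a. finite R \<and> R \<subseteq> \<Gamma> \<longrightarrow>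
        norm (J (x + (\<Sum>r\<in>R. scale_linf (a r) (char_seq (N r))))) =
          max (norm (x + (\<Sum>r\<in>R. scale_linf (a r) (char_seq (N r)))))
              (sqrt (\<Sum>r\<in>R. (norm (a r))\<^sup>2))) \<and>
     closure (J ` JL_span N \<Gamma>) = UNIV"

end

theory Submission
  imports Defs "HOL-Library.Diagonal_Subsequence" "HOL-Complex_Analysis.Great_Picard"
begin

text \<open>A functional in the dual ball is determined by its values at the images \<open>e j\<close> of the unit
  vectors of \<open>c\<^sub>0\<close> and \<open>u r\<close> of the characteristic functions of the sets \<open>N r\<close>. After removing
  finite overlaps the vectors \<open>u r\<close>, for \<open>r\<close> in a finite set, span an isometric copy of a
  Euclidean space, so the values at the \<open>u r\<close> of the difference of two functionals are
  square-summable up to finitely many values at the \<open>e j\<close>. Two consequences follow.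
  Functionals that agree at all \<open>e j\<close> differ at countably many \<open>u r\<close> only, and the dual ball is
  weak-star sequentially compact: for each \<open>\<epsilon>\<close> some subsequence stays \<open>\<epsilon>\<close>-close to a
  cluster point at all but finitely many \<open>u r\<close>, and diagonal arguments finish.

  If \<open>f\<close> lies in the closure of \<open>F\<close>, sequential compactness gives, for each countable set \<open>C\<close> of
  indices, a limit of a sequence in \<open>F\<close> that agrees with \<open>f\<close> at all \<open>e j\<close> and at \<open>u r\<close> for
  \<open>r \<in> C\<close>. Choosing such limits inductively, each agreeing with \<open>f\<close> wherever an earlier one
  differs from it, yields a sequence converging to \<open>f\<close>. So two sequential closures suffice.

  One does not, by the coordinate functionals \<open>\<delta> n\<close>: along \<open>N r\<close> they converge to a functional
  dual to \<open>u r\<close>, and these converge to \<open>0\<close> along distinct \<open>r\<close>. By maximality, every infinite set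
  of integers meets some \<open>N r\<close> infinitely often, so no sequence of \<open>\<delta> n\<close> converges to \<open>0\<close>.\<close>

subsection \<open>The topology of pointwise convergence on the dual ball\<close>

text \<open>The strong operator topology is pulled back from the product topology along
  \<open>blinfun_apply\<close>, so convergence is componentwise. Membership of \<open>s n\<close> in
  the ball is only eventual, as for limits in any subtopology.\<close>

lemma limitin_weak_star_dual_ball:
  "limitin (weak_star_dual_ball smul) s l sequentially \<longleftrightarrow>
     l \<in> dual_ball smul \<and> (\<forall>\<^sub>F n in sequentially. s n \<in> dual_ball smul) \<and>
     (\<forall>x. (\<lambda>n. blinfun_apply (s n) x) \<longlonglongrightarrow> blinfun_apply l x)"
proof -
  have "limitin strong_operator_topology s l sequentially \<longleftrightarrow>
      ((\<lambda>n. blinfun_apply (s n)) \<longlongrightarrow> blinfun_apply l) sequentially"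
    unfolding limitin_def strong_operator_topology_def openin_pullback_topology
      topspace_pullback_topology tendsto_def
    by auto
  also have "\<dots> \<longleftrightarrow> (\<forall>x. (\<lambda>n. blinfun_apply (s n) x) \<longlonglongrightarrow> blinfun_apply l x)"
    using limitin_componentwise[of "\<lambda>_. euclidean" UNIV "\<lambda>n. blinfun_apply (s n)"
        "blinfun_apply l" sequentially]
    by (simp add: euclidean_product_topology)
  finally show ?thesis
    by (auto simp: weak_star_dual_ball_def limitin_subtopology)
qed

lemma topspace_weak_star_dual_ball: "topspace (weak_star_dual_ball smul) = dual_ball smul"
  by (simp add: weak_star_dual_ball_def strong_operator_topology_topspace)

lemma weak_star_closure_approx:
  assumes "f \<in> weak_star_dual_ball smul closure_of F" and "finite X" and "\<epsilon> > 0"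
  obtains g where "g \<in> F" "g \<in> dual_ball smul"
    "\<And>x. x \<in> X \<Longrightarrow> dist (blinfun_apply g x) (blinfun_apply f x) < \<epsilon>"
proof -
  define U where "U = {g. \<forall>x\<in>X. blinfun_apply g x \<in> ball (blinfun_apply f x) \<epsilon>}"
  have "openin strong_operator_topology U"
    using strong_operator_topology_basis[of X "\<lambda>x. ball (blinfun_apply f x) \<epsilon>" "\<lambda>x. x"] assms(2)
    by (simp add: U_def)
  then have "openin (weak_star_dual_ball smul) (dual_ball smul \<inter> U)"
    unfolding weak_star_dual_ball_def by (rule openin_subtopology_Int2)
  moreover have "f \<in> dual_ball smul \<inter> U"
    using assms(1,3) by (simp add: in_closure_of topspace_weak_star_dual_ball U_def)
  moreover have "\<And>V. f \<in> V \<Longrightarrow> openin (weak_star_dual_ball smul) V \<Longrightarrow> \<exists>g. g \<in> F \<and> g \<in> V"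
    using assms(1) by (simp add: in_closure_of)
  ultimately obtain g where "g \<in> F" "g \<in> dual_ball smul \<inter> U"
    by metis
  then show thesis
    using that by (auto simp: dist_commute U_def)
qed

section \<open>Iterated sequential closures\<close>

lemma seq_closure_of_subset_closure_of: "seq_closure_of T F \<subseteq> T closure_of F"
proof
  fix l assume "l \<in> seq_closure_of T F"
  then obtain s :: "nat \<Rightarrow> 'a"
    where l: "l \<in> topspace T" and s: "\<And>n. s n \<in> F" and lim: "limitin T s l sequentially"
    by (auto simp: seq_closure_of_def)
  have "\<exists>y. y \<in> F \<and> y \<in> U" if "l \<in> U" "openin T U" for U
    using lim that s unfolding limitin_def by (meson eventually_sequentially le_refl)
  then show "l \<in> T closure_of F"
    using l by (simp add: in_closure_of)
qed

lemma seq_closure_iter_subset_closure_of: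
  assumes "F \<subseteq> topspace T"
  shows "seq_closure_iter T n F \<subseteq> T closure_of F"
proof (induction n)
  case (Suc n)
  have "seq_closure_iter T (Suc n) F \<subseteq> T closure_of (seq_closure_iter T n F)"
    by (simp add: seq_closure_of_subset_closure_of)
  also have "\<dots> \<subseteq> T closure_of (T closure_of F)"
    by (rule closure_of_mono[OF Suc])
  finally show ?case
    by simp
qed (simp add: assms closure_of_subset)

lemma seq_closure_iter_2I:
  assumes "\<And>n. s n \<in> seq_closure_of T F" and "limitin T s l sequentially"
  shows "l \<in> seq_closure_iter T 2 F"
proof -
  have "l \<in> seq_closure_of T (seq_closure_of T F)"
    unfolding seq_closure_of_def[of T "seq_closure_of T F"]
    by (intro CollectI conjI exI[of _ s] allI assms limitin_topspace[OF assms(2)])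
  then show ?thesis
    by (simp add: numeral_2_eq_2)
qed

text \<open>A sequentially closed set is fixed by every stage of the iteration, so by assumption it
  equals its closure.\<close>

lemma sequential_space_if_seq_closure_iter_2:
  assumes "\<And>F. F \<subseteq> topspace T \<Longrightarrow> seq_closure_iter T 2 F = T closure_of F"
  shows "sequential_space T"
  unfolding sequential_space_def seq_closedin_def
proof safe
  fix F assume F: "F \<subseteq> topspace T" "seq_closure_of T F = F"
  then have "T closure_of F = F"
    using assms[OF F(1)] by (simp add: numeral_2_eq_2)
  then show "closedin T F"
    using closedin_closure_of[of T F] by simp
qed

text \<open>Tychonoff: the product of the closed balls, compact by \<open>heine_borel\<close>,
  contains a cluster point \<open>h\<close>. Over an uncountable index type compactness alone need
  not give a convergent subsequence.\<close>

lemma bounded_functions_cluster_point: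
  fixes c :: "nat \<Rightarrow> 'a \<Rightarrow> 'b::heine_borel"
  assumes "\<And>n r. c n r \<in> cball (z r) (M r)"
  shows "\<exists>h. \<forall>R \<epsilon> m. finite R \<longrightarrow> \<epsilon> > 0 \<longrightarrow> (\<exists>n\<ge>m. \<forall>r\<in>R. dist (c n r) (h r) < \<epsilon>)"
proof -
  define C where "C = PiE UNIV (\<lambda>r. cball (z r) (M r))"
  have "compactin (product_topology (\<lambda>_. euclidean) UNIV) C"
    unfolding C_def compactin_PiE by simp
  then have "compact C"
    by (simp add: euclidean_product_topology)
  moreover have "eventually (\<lambda>f. f \<in> C) (filtermap c sequentially)"
    using assms by (simp add: C_def eventually_filtermap PiE_iff)
  moreover have "filtermap c sequentially \<noteq> bot"
    by (simp add: filtermap_bot_iff)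
  ultimately have "\<exists>h\<in>C. inf (nhds h) (filtermap c sequentially) \<noteq> bot"
    unfolding compact_filter by blast
  then obtain h where h: "inf (nhds h) (filtermap c sequentially) \<noteq> bot" ..
  have "\<exists>n\<ge>m. \<forall>r\<in>R. dist (c n r) (h r) < \<epsilon>" if "finite R" "\<epsilon> > 0" for R \<epsilon> m
  proof (rule ccontr)
    assume *: "\<not> ?thesis"
    define U where "U = {f. \<forall>r\<in>R. f r \<in> ball (h r) \<epsilon>}"
    have "open U"
      unfolding U_def using product_topology_basis'[of R "\<lambda>r. ball (h r) \<epsilon>" "\<lambda>r. r"] that by simp
    then have "eventually (\<lambda>f. f \<in> U) (nhds h)"
      using that by (intro eventually_nhds_in_open) (auto simp: U_def)
    \<comment> \<open>By the assumption to be refuted, all terms from \<open>m\<close> on stay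
      outside the neighbourhood \<open>U\<close> of \<open>h\<close>.\<close>
    moreover have "eventually (\<lambda>f. f \<notin> U) (filtermap c sequentially)"
      unfolding eventually_filtermap eventually_sequentially U_def
      using * by (auto simp: dist_commute)
    ultimately have "eventually (\<lambda>_. False) (inf (nhds h) (filtermap c sequentially))"
      unfolding eventually_inf by blast
    with h show False
      by (simp add: eventually_False)
  qed
  then show ?thesis
    by blast
qed

subsection \<open>The dense subspace\<close>

interpretation linf: vector_space
  "scale_linf :: 'k::real_normed_field \<Rightarrow> (nat \<Rightarrow>\<^sub>C 'k) \<Rightarrow> (nat \<Rightarrow>\<^sub>C 'k)"
  by (rule vector_space_scale_linf)

lemma apply_bcontfun_sum:
  "apply_bcontfun (\<Sum>i\<in>I. f i) x = (\<Sum>i\<in>I. apply_bcontfun (f i) x)"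
  by (induction I rule: infinite_finite_induct) (auto simp: plus_bcontfun.rep_eq)

lemma subspace_c0_space: "linf.subspace (c0_space :: (nat \<Rightarrow>\<^sub>C 'k::real_normed_field) set)"
  by (auto simp: linf.subspace_def c0_space_def plus_bcontfun.rep_eq ext[OF apply_scale_linf]
      intro: tendsto_add_zero tendsto_mult_right_zero)

lemma char_seq_finite_in_c0_space:
  assumes "finite A"
  shows "char_seq A \<in> c0_space"
proof -
  obtain m where m: "\<And>n. n \<in> A \<Longrightarrow> n < m"
    using assms finite_nat_set_iff_bounded by auto
  then have "eventually (\<lambda>n. indicator A n = (0::'a)) sequentially"
    by (intro eventually_sequentiallyI[of m]) (auto simp: indicator_def dest: leD m)
  then show ?thesis
    by (simp add: c0_space_def apply_char_seq tendsto_eventually)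
qed

lemma char_seq_finite:
  assumes "finite A"
  shows "char_seq A = (\<Sum>j\<in>A. char_seq {j})"
  using assms
  by (intro bcontfun_eqI) (auto simp: apply_bcontfun_sum apply_char_seq indicator_def sum.delta')

text \<open>Injectivity turns almost disjointness of the image into finiteness of
  \<open>N r \<inter> N s\<close> for distinct indices; \<open>heine_borel\<close> makes the scalars
  complete with compact closed balls.\<close>

locale JL_completion =
  fixes N :: "'i \<Rightarrow> nat set" and \<Gamma> :: "'i set"
    and smul :: "'k::{real_normed_field,heine_borel} \<Rightarrow> 'x::banach \<Rightarrow> 'x"
    and J :: "(nat \<Rightarrow>\<^sub>C 'k) \<Rightarrow> 'x"
  assumes inj: "inj_on N \<Gamma>"
    and ad: "almost_disjoint (N ` \<Gamma>)"
    and JL2: "is_JL2 N \<Gamma> smul J"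
begin

sublocale banach_space_over smul
  using JL2 by (simp add: is_JL2_def)

definition e :: "nat \<Rightarrow> 'x" where "e j = J (char_seq {j})"

definition u :: "'i \<Rightarrow> 'x" where "u r = J (char_seq (N r))"

abbreviation JLs where "JLs \<equiv> JL_span N \<Gamma> :: (nat \<Rightarrow>\<^sub>C 'k) set"

abbreviation K where "K \<equiv> dual_ball smul"

lemma subspace_span: "linf.subspace JLs"
  unfolding JL_span_def by (rule linf.subspace_span)

lemma c0_in_span: "x \<in> c0_space \<Longrightarrow> x \<in> JLs"
  unfolding JL_span_def by (intro linf.span_base) simp

lemma char_seq_finite_in_span: "finite A \<Longrightarrow> char_seq A \<in> JLs"
  by (simp add: c0_in_span char_seq_finite_in_c0_space)

lemma char_seq_N_in_span: "r \<in> \<Gamma> \<Longrightarrow> char_seq (N r) \<in> JLs"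
  unfolding JL_span_def by (intro linf.span_base) simp

lemma J_add: "f \<in> JLs \<Longrightarrow> g \<in> JLs \<Longrightarrow> J (f + g) = J f + J g"
  and J_scale: "f \<in> JLs \<Longrightarrow> J (scale_linf c f) = smul c (J f)"
  using JL2 by (auto simp: is_JL2_def)

lemma J_0: "J 0 = 0"
  using J_add[of 0 0] linf.subspace_0[OF subspace_span] by simp

lemma J_diff:
  assumes "f \<in> JLs" "g \<in> JLs"
  shows "J (f - g) = J f - J g"
  using J_add[of "f - g" g] linf.subspace_diff[OF subspace_span] assms by simp

lemma J_sum:
  assumes "\<And>i. i \<in> I \<Longrightarrow> f i \<in> JLs"
  shows "J (\<Sum>i\<in>I. f i) = (\<Sum>i\<in>I. J (f i))"
  using assms
proof (induction I rule: infinite_finite_induct)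
  case (insert i I)
  then have "(\<Sum>i\<in>I. f i) \<in> JLs"
    by (intro linf.subspace_sum[OF subspace_span]) auto
  then show ?case
    using insert by (simp add: J_add)
qed (simp_all add: J_0)

lemma norm_J:
  assumes "x \<in> c0_space" "finite R" "R \<subseteq> \<Gamma>"
  shows "norm (J (x + (\<Sum>r\<in>R. scale_linf (a r) (char_seq (N r))))) =
    max (norm (x + (\<Sum>r\<in>R. scale_linf (a r) (char_seq (N r))))) (sqrt (\<Sum>r\<in>R. (norm (a r))\<^sup>2))"
  using JL2 assms unfolding is_JL2_def by blast

lemma norm_J_c0: "x \<in> c0_space \<Longrightarrow> norm (J x) = norm x"
  using norm_J[of x "{}"] by simp

text \<open>Elements of the span are sums over vectors. A set \<open>R\<close> of indices with
  distinct characteristic functions reindexes them to the form required by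
  \<open>norm_J\<close>.\<close>

lemma span_cases:
  assumes "f \<in> JLs"
  obtains x R a where "x \<in> c0_space" "finite R" "R \<subseteq> \<Gamma>"
    "f = x + (\<Sum>r\<in>R. scale_linf (a r) (char_seq (N r)))"
proof -
  obtain x y where x: "x \<in> linf.span c0_space" and f: "f = x + y"
    and y: "y \<in> linf.span ((\<lambda>r. char_seq (N r)) ` \<Gamma>)"
    using assms unfolding JL_span_def linf.span_Un by blast
  obtain t b where t: "finite t" "t \<subseteq> (\<lambda>r. char_seq (N r)) ` \<Gamma>"
    and y_eq: "y = (\<Sum>v\<in>t. scale_linf (b v) v)"
    using y unfolding linf.span_explicit by blast
  obtain R where R: "R \<subseteq> \<Gamma>" "inj_on (\<lambda>r. char_seq (N r) :: nat \<Rightarrow>\<^sub>C 'k) R"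
    "t = (\<lambda>r. char_seq (N r)) ` R"
    using t(2) unfolding subset_image_inj by blast
  have "finite R"
    using t(1) R finite_image_iff by metis
  moreover have "y = (\<Sum>r\<in>R. scale_linf (b (char_seq (N r))) (char_seq (N r)))"
    unfolding y_eq R(3) by (simp add: sum.reindex[OF R(2)])
  moreover have "x \<in> c0_space"
    using x unfolding linf.span_eq_iff[THEN iffD2, OF subspace_c0_space] .
  ultimately show thesis
    using that[of x R "\<lambda>r. b (char_seq (N r))"] R(1) f by simp
qed

lemma norm_le_norm_J:
  assumes "f \<in> JLs"
  shows "norm f \<le> norm (J f)"
proof -
  obtain x R a where "x \<in> c0_space" "finite R" "R \<subseteq> \<Gamma>"
    "f = x + (\<Sum>r\<in>R. scale_linf (a r) (char_seq (N r)))"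
    using span_cases[OF assms] .
  then show ?thesis
    using norm_J[of x R a] by simp
qed

lemma J_char_seq_finite: "finite A \<Longrightarrow> J (char_seq A) = (\<Sum>j\<in>A. e j)"
  by (simp add: char_seq_finite[of A] J_sum char_seq_finite_in_span e_def)

text \<open>The \<open>e j\<close> and \<open>u r\<close> span a dense subspace, put here as an
  induction rule for closed sets: truncations exhaust \<open>c0_space\<close>, finite sums give the
  rest of \<open>JLs\<close>, and the image of \<open>JLs\<close> under \<open>J\<close> is
  dense.\<close>

lemma total:
  assumes "closed S" "0 \<in> S" and add: "\<And>x y. x \<in> S \<Longrightarrow> y \<in> S \<Longrightarrow> x + y \<in> S"
    and smul: "\<And>c x. x \<in> S \<Longrightarrow> smul c x \<in> S"
    and e: "\<And>j. e j \<in> S" and u: "\<And>r. r \<in> \<Gamma> \<Longrightarrow> u r \<in> S"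
  shows "x \<in> S"
proof -
  have sum: "(\<Sum>i\<in>I. v i) \<in> S" if "\<And>i. i \<in> I \<Longrightarrow> v i \<in> S" for I and v :: "'b \<Rightarrow> 'x"
    using that by (induction I rule: infinite_finite_induct) (auto intro: add \<open>0 \<in> S\<close>)
  have c0: "J f \<in> S" if f: "f \<in> c0_space" for f
  proof -
    define t where "t m = (\<Sum>j<m. scale_linf (apply_bcontfun f j) (char_seq {j}))" for m
    have t_c0: "t m \<in> c0_space" for m
      unfolding t_def
      by (intro linf.subspace_sum[OF subspace_c0_space] linf.subspace_scale[OF subspace_c0_space]
          char_seq_finite_in_c0_space) simp
    have t_apply: "apply_bcontfun (t m) n = (if n < m then apply_bcontfun f n else 0)" for m n
      by (simp add: t_def apply_bcontfun_sum apply_scale_linf apply_char_seq indicator_def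
          if_distrib[of "\<lambda>x. _ * x"] cong: if_cong)
    have "J (t m) = (\<Sum>j<m. smul (apply_bcontfun f j) (e j))" for m
      unfolding t_def e_def
      by (subst J_sum)
        (auto simp: J_scale char_seq_finite_in_span intro!: linf.subspace_scale[OF subspace_span])
    then have "J (t m) \<in> S" for m
      by (simp add: sum smul e)
    moreover have "(\<lambda>m. J (t m)) \<longlonglongrightarrow> J f"
    proof (rule LIMSEQ_I)
      fix \<epsilon> :: real assume "\<epsilon> > 0"
      then obtain m0 where m0: "\<And>n. n \<ge> m0 \<Longrightarrow> norm (apply_bcontfun f n) < \<epsilon> / 2"
        using LIMSEQ_D[of "apply_bcontfun f" 0 "\<epsilon> / 2"] f by (auto simp: c0_space_def)
      have "norm (J (t m) - J f) < \<epsilon>" if "m \<ge> m0" for m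
      proof -
        have "t m - f \<in> c0_space"
          using t_c0 f by (rule linf.subspace_diff[OF subspace_c0_space])
        then have "norm (J (t m) - J f) = norm (t m - f)"
          using t_c0 f by (simp add: c0_in_span norm_J_c0 flip: J_diff)
        also have "\<dots> \<le> \<epsilon> / 2"
          using m0 that \<open>\<epsilon> > 0\<close>
          by (intro norm_bound) (auto simp: minus_bcontfun.rep_eq t_apply intro: less_imp_le)
        finally show ?thesis
          using \<open>\<epsilon> > 0\<close> by simp
      qed
      then show "\<exists>m0. \<forall>m\<ge>m0. norm (J (t m) - J f) < \<epsilon>"
        by blast
    qed
    ultimately show ?thesis
      using closed_sequentially[OF \<open>closed S\<close>, of "\<lambda>m. J (t m)"] by simp
  qed
  have "J f \<in> S" if f_in: "f \<in> JLs" for f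
  proof -
    obtain x R a where x: "x \<in> c0_space" and R: "finite R" "R \<subseteq> \<Gamma>"
      and f: "f = x + (\<Sum>r\<in>R. scale_linf (a r) (char_seq (N r)))"
      using span_cases[OF f_in] .
    have *: "scale_linf (a r) (char_seq (N r)) \<in> JLs" if "r \<in> R" for r
      using that R char_seq_N_in_span linf.subspace_scale[OF subspace_span] by blast
    have "J f = J x + J (\<Sum>r\<in>R. scale_linf (a r) (char_seq (N r)))"
      unfolding f using c0_in_span[OF x] * by (intro J_add linf.subspace_sum[OF subspace_span])
    also have "\<dots> = J x + (\<Sum>r\<in>R. smul (a r) (u r))"
      using * R by (subst J_sum) (auto simp: J_scale u_def char_seq_N_in_span subset_iff)
    also have "\<dots> \<in> S"
      using R by (intro add sum smul u c0 x) auto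
    finally show ?thesis .
  qed
  then have "closure (J ` JLs) \<subseteq> S"
    using \<open>closed S\<close> by (intro closure_minimal) auto
  then show ?thesis
    using JL2 by (auto simp: is_JL2_def)
qed

section \<open>Square sums for differences of functionals in the dual ball\<close>

lemma dual_ball_diff:
  assumes "f \<in> K" "g \<in> K"
  shows "blinfun_apply (f - g) (smul c x) = c * blinfun_apply (f - g) x" and "norm (f - g) \<le> 2"
proof -
  show "blinfun_apply (f - g) (smul c x) = c * blinfun_apply (f - g) x"
    using assms by (simp add: dual_ball_def blinfun.diff_left right_diff_distrib)
  show "norm (f - g) \<le> 2"
    using assms norm_triangle_ineq4[of f g] by (simp add: dual_ball_def)
qed

text \<open>Outside the finite set \<open>D\<close> of overlaps the sets \<open>N r\<close> are
  disjoint, so the vectors \<open>u r\<close> without their parts on \<open>D\<close> behave like an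
  orthonormal system. Testing a functional of norm at most 2 on a combination with coefficients
  matched to its values gives \<open>Q \<le> 2 * sqrt Q\<close>, hence the bound 4. \<open>D\<close>
  depends on \<open>R\<close> only, not on \<open>f\<close> and \<open>g\<close>.\<close>

lemma overlap_sum_squares_le:
  assumes "finite R" "R \<subseteq> \<Gamma>"
  shows "\<exists>D. finite D \<and> (\<forall>f\<in>K. \<forall>g\<in>K.
    (\<Sum>r\<in>R. (norm (blinfun_apply (f - g) (u r) -
      (\<Sum>j\<in>D \<inter> N r. blinfun_apply (f - g) (e j))))\<^sup>2) \<le> 4)"
proof -
  define D where "D = (\<Union>r\<in>R. \<Union>s\<in>R - {r}. N r \<inter> N s)"
  have "finite (N r \<inter> N s)" if "r \<in> R" "s \<in> R - {r}" for r s
    using that assms(2) ad inj unfolding almost_disjoint_def inj_on_def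
    by (metis DiffD1 DiffD2 image_eqI insertI1 subsetD)
  then have "finite D"
    unfolding D_def by (intro finite_UN_I finite_Diff assms(1)) auto
  have *: "(\<Sum>r\<in>R. (norm (blinfun_apply \<phi> (u r) - (\<Sum>j\<in>D \<inter> N r. blinfun_apply \<phi> (e j))))\<^sup>2) \<le> 4"
    if lin: "\<And>c x. blinfun_apply \<phi> (smul c x) = c * blinfun_apply \<phi> x" and nrm: "norm \<phi> \<le> 2"
    for \<phi> :: "'x \<Rightarrow>\<^sub>L 'k"
  proof -
    define b where "b r = blinfun_apply \<phi> (u r) - (\<Sum>j\<in>D \<inter> N r. blinfun_apply \<phi> (e j))" for r
    \<comment> \<open>Conjugation need not exist in \<open>'k\<close>; dividing gives \<open>a r * b r = (norm (b r))\<^sup>2\<close>, also if \<open>b r = 0\<close>.\<close>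
    define a where "a r = of_real ((norm (b r))\<^sup>2) / b r" for r
    define Q where "Q = (\<Sum>r\<in>R. (norm (b r))\<^sup>2)"
    have norm_a: "norm (a r) = norm (b r)" and ab: "a r * b r = of_real ((norm (b r))\<^sup>2)" for r
      by (auto simp: a_def norm_divide norm_mult power2_eq_square)
    \<comment> \<open>\<open>x\<close> cancels the parts on \<open>D\<close> and lies in
      \<open>c0_space\<close>, so \<open>y\<close> has the form to which \<open>norm_J\<close>
      applies.\<close>
    define x where "x = - (\<Sum>r\<in>R. scale_linf (a r) (char_seq (D \<inter> N r)))"
    define y where "y = x + (\<Sum>r\<in>R. scale_linf (a r) (char_seq (N r)))"
    have x: "x \<in> c0_space"
      unfolding x_def using \<open>finite D\<close>
      by (intro linf.subspace_neg[OF subspace_c0_space] linf.subspace_sum[OF subspace_c0_space]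
          linf.subspace_scale[OF subspace_c0_space] char_seq_finite_in_c0_space) simp
    have y_eq: "y = (\<Sum>r\<in>R. scale_linf (a r) (char_seq (N r) - char_seq (D \<inter> N r)))"
      by (simp add: y_def x_def linf.scale_right_diff_distrib sum_subtractf)
    have "Q \<ge> 0"
      by (simp add: Q_def sum_nonneg)
    have "norm y \<le> sqrt Q"
    proof (rule norm_bound)
      fix n
      have y_apply: "apply_bcontfun y n = (\<Sum>r\<in>R. a r * indicator (N r - D) n)"
        by (simp add: y_eq apply_bcontfun_sum apply_scale_linf minus_bcontfun.rep_eq
            apply_char_seq indicator_def cong: sum.cong) (intro sum.cong, auto)
      show "norm (apply_bcontfun y n) \<le> sqrt Q"
      proof (cases "\<exists>r\<in>R. n \<in> N r - D")
        case True
        then obtain r where r: "r \<in> R" "n \<in> N r - D" by blast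
        \<comment> \<open>Off \<open>D\<close> the sets are disjoint, so only the coefficient
          \<open>a r\<close> survives at \<open>n\<close>.\<close>
        have "n \<notin> N s - D" if "s \<in> R - {r}" for s
          using that r unfolding D_def by blast
        then have "apply_bcontfun y n = a r"
          unfolding y_apply using r assms(1) by (subst sum.remove[of R r]) auto
        then have "(norm (apply_bcontfun y n))\<^sup>2 \<le> Q"
          unfolding Q_def norm_a using r assms(1)
          by (auto simp: norm_a intro: member_le_sum)
        then show ?thesis
          by (rule real_le_rsqrt)
      next
        case False
        then have "apply_bcontfun y n = 0"
          unfolding y_apply by (intro sum.neutral) auto
        then show ?thesis
          using \<open>Q \<ge> 0\<close> by simp
      qed
    qed
    \<comment> \<open>Both entries of the maximum are at most \<open>sqrt Q\<close>: the supremum by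
      disjointness, the Euclidean norm since \<open>norm (a r) = norm (b r)\<close>.\<close>
    then have "norm (J y) \<le> sqrt Q"
      unfolding y_def using norm_J[OF x assms] by (simp add: norm_a Q_def)
    have *: "char_seq (N r) - char_seq (D \<inter> N r) \<in> JLs" if "r \<in> R" for r
      using that assms \<open>finite D\<close>
      by (intro linf.subspace_diff[OF subspace_span] char_seq_N_in_span char_seq_finite_in_span) auto
    have "J (char_seq (N r) - char_seq (D \<inter> N r)) = u r - (\<Sum>j\<in>D \<inter> N r. e j)" if "r \<in> R" for r
      using that assms \<open>finite D\<close>
      by (subst J_diff) (auto simp: u_def J_char_seq_finite char_seq_N_in_span char_seq_finite_in_span)
    then have "J y = (\<Sum>r\<in>R. smul (a r) (u r - (\<Sum>j\<in>D \<inter> N r. e j)))"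
      unfolding y_eq using *
      by (subst J_sum) (auto simp: J_scale intro!: linf.subspace_scale[OF subspace_span])
    \<comment> \<open>By linearity the value is the sum of the \<open>a r * b r\<close>, which the
      choice of \<open>a\<close> makes equal to \<open>Q\<close>.\<close>
    then have "blinfun_apply \<phi> (J y) = of_real Q"
      by (simp add: blinfun.sum_right lin blinfun.diff_right Q_def ab flip: b_def)
    then have "Q = norm (blinfun_apply \<phi> (J y))"
      using \<open>Q \<ge> 0\<close> by simp
    also have "\<dots> \<le> norm \<phi> * norm (J y)"
      by (rule norm_blinfun)
    also have "\<dots> \<le> 2 * sqrt Q"
      using nrm \<open>norm (J y) \<le> sqrt Q\<close> by (intro mult_mono) auto
    finally have "sqrt Q * sqrt Q \<le> 2 * sqrt Q"
      using \<open>Q \<ge> 0\<close> by simp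
    then have "sqrt Q \<le> 2"
      using mult_right_le_imp_le[of "sqrt Q" "sqrt Q" 2] by (cases "sqrt Q > 0") linarith+
    then show ?thesis
      using real_sqrt_le_iff[of Q 4] by (simp add: Q_def b_def)
  qed
  show ?thesis
    by (intro exI[of _ D] conjI ballI \<open>finite D\<close> * dual_ball_diff)
qed

section \<open>Pointwise limits in the dual ball\<close>

lemma norm_apply_dual_ball_le: "f \<in> K \<Longrightarrow> norm (blinfun_apply f x) \<le> norm x"
  using norm_blinfun[of f x] mult_right_mono[of "norm f" 1 "norm x"] by (auto simp: dual_ball_def)

text \<open>As the \<open>s n\<close> are uniformly bounded, the vectors at which they are Cauchy
  form a closed set, and \<open>total\<close> spreads convergence from the \<open>e j\<close> and
  \<open>u r\<close> to all vectors. Linearity and the norm bound pass to the limit.\<close>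

lemma dual_ball_pointwise_convergent:
  assumes s: "\<And>n. s n \<in> K"
    and e: "\<And>j. convergent (\<lambda>n. blinfun_apply (s n) (e j))"
    and u: "\<And>r. r \<in> \<Gamma> \<Longrightarrow> convergent (\<lambda>n. blinfun_apply (s n) (u r))"
  obtains f where "limitin (weak_star_dual_ball smul) s f sequentially"
proof -
  have lin: "blinfun_apply (s n) (smul c x) = c * blinfun_apply (s n) x" for n c x
    using s by (auto simp: dual_ball_def)
  define S where "S = {x. Cauchy (\<lambda>n. blinfun_apply (s n) x)}"
  have "closed S"
    unfolding closed_sequential_limits
  proof (intro allI impI, elim conjE)
    fix v x assume v: "\<forall>k. v k \<in> S" and lim: "v \<longlonglongrightarrow> x"
    have "Cauchy (\<lambda>n. blinfun_apply (s n) x)"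
    proof (rule CauchyI)
      fix \<epsilon> :: real assume "\<epsilon> > 0"
      then obtain k where k: "norm (x - v k) < \<epsilon> / 3"
        using LIMSEQ_D[OF lim, of "\<epsilon> / 3"] by (auto simp: norm_minus_commute)
      obtain M where M: "\<And>m n. m \<ge> M \<Longrightarrow> n \<ge> M \<Longrightarrow>
          norm (blinfun_apply (s m) (v k) - blinfun_apply (s n) (v k)) < \<epsilon> / 3"
        using CauchyD[of "\<lambda>n. blinfun_apply (s n) (v k)" "\<epsilon> / 3"] v \<open>\<epsilon> > 0\<close> by (auto simp: S_def)
      have "norm (blinfun_apply (s m) x - blinfun_apply (s n) x) < \<epsilon>" if "m \<ge> M" "n \<ge> M" for m n
      proof -
        \<comment> \<open>The terms at \<open>x - v k\<close> are below
          \<open>\<epsilon> / 3\<close> for all indices at once, by the uniform bound.\<close>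
        have "blinfun_apply (s m) x - blinfun_apply (s n) x =
            (blinfun_apply (s m) (v k) - blinfun_apply (s n) (v k)) +
            (blinfun_apply (s m) (x - v k) - blinfun_apply (s n) (x - v k))"
          by (simp add: blinfun.diff_right)
        also have "norm \<dots> \<le> norm (blinfun_apply (s m) (v k) - blinfun_apply (s n) (v k)) +
            (norm (blinfun_apply (s m) (x - v k)) + norm (blinfun_apply (s n) (x - v k)))"
          by (intro norm_triangle_le add_left_mono norm_triangle_ineq4)
        also have "\<dots> < \<epsilon> / 3 + (\<epsilon> / 3 + \<epsilon> / 3)"
          by (intro add_strict_mono M that le_less_trans[OF norm_apply_dual_ball_le[OF s] k])
        finally show ?thesis
          by simp
      qed
      then show "\<exists>M. \<forall>m\<ge>M. \<forall>n\<ge>M. norm (blinfun_apply (s m) x - blinfun_apply (s n) x) < \<epsilon>"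
        by blast
    qed
    then show "x \<in> S"
      by (simp add: S_def)
  qed
  then have "x \<in> S" for x
  proof (rule total)
    show "0 \<in> S"
      by (simp add: S_def Cauchy_convergent_iff convergent_const)
  next
    fix x y assume "x \<in> S" "y \<in> S"
    then show "x + y \<in> S"
      by (simp add: S_def blinfun.add_right Cauchy_convergent_iff convergent_add)
  next
    fix c x assume "x \<in> S"
    then obtain L where "(\<lambda>n. blinfun_apply (s n) x) \<longlonglongrightarrow> L"
      by (auto simp: S_def Cauchy_convergent_iff convergent_def)
    then have "(\<lambda>n. c * blinfun_apply (s n) x) \<longlonglongrightarrow> c * L"
      by (rule tendsto_mult_left)
    then show "smul c x \<in> S"
      by (auto simp: S_def lin Cauchy_convergent_iff convergent_def)
  qed (use e u in \<open>auto simp: S_def Cauchy_convergent_iff\<close>)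
  then have conv: "convergent (\<lambda>n. blinfun_apply (s n) x)" for x
    by (simp add: S_def Cauchy_convergent_iff)
  define g where "g x = lim (\<lambda>n. blinfun_apply (s n) x)" for x
  have g: "(\<lambda>n. blinfun_apply (s n) x) \<longlonglongrightarrow> g x" for x
    using conv[of x] unfolding g_def convergent_LIMSEQ_iff .
  have g_le: "norm (g x) \<le> norm x" for x
    using tendsto_norm[OF g] norm_apply_dual_ball_le[OF s]
    by (intro LIMSEQ_le_const2[of "\<lambda>n. norm (blinfun_apply (s n) x)"]) auto
  have "bounded_linear g"
  proof (rule bounded_linear_intro[of _ 1])
    fix x y :: 'x and t :: real
    have "(\<lambda>n. blinfun_apply (s n) (x + y)) \<longlonglongrightarrow> g x + g y"
      unfolding blinfun.add_right by (intro tendsto_add g)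
    then show "g (x + y) = g x + g y"
      using g LIMSEQ_unique by blast
    have "(\<lambda>n. blinfun_apply (s n) (t *\<^sub>R x)) \<longlonglongrightarrow> t *\<^sub>R g x"
      unfolding blinfun.scaleR_right by (intro tendsto_scaleR g tendsto_const)
    then show "g (t *\<^sub>R x) = t *\<^sub>R g x"
      using g LIMSEQ_unique by blast
  qed (simp add: g_le)
  then have Blinfun_g: "blinfun_apply (Blinfun g) = g"
    by (rule bounded_linear_Blinfun_apply)
  have "g (smul c x) = c * g x" for c x
  proof -
    have "(\<lambda>n. blinfun_apply (s n) (smul c x)) \<longlonglongrightarrow> c * g x"
      unfolding lin by (intro tendsto_mult_left g)
    then show ?thesis
      using g LIMSEQ_unique by blast
  qed
  moreover have "norm (Blinfun g) \<le> 1"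
    by (rule norm_blinfun_bound) (simp_all add: Blinfun_g g_le)
  ultimately have "Blinfun g \<in> K"
    by (simp add: dual_ball_def Blinfun_g)
  then have "limitin (weak_star_dual_ball smul) s (Blinfun g) sequentially"
    using s g by (simp add: limitin_weak_star_dual_ball Blinfun_g)
  then show thesis
    by (rule that)
qed

text \<open>Some limit \<open>g\<close> exists by \<open>dual_ball_pointwise_convergent\<close>; it
  agrees with \<open>f\<close> at all \<open>e j\<close> and \<open>u r\<close>, hence everywhere by
  \<open>total\<close>.\<close>

lemma dual_ball_limitin:
  assumes s: "\<And>n. s n \<in> K" and f: "f \<in> K"
    and e: "\<And>j. (\<lambda>n. blinfun_apply (s n) (e j)) \<longlonglongrightarrow> blinfun_apply f (e j)"
    and u: "\<And>r. r \<in> \<Gamma> \<Longrightarrow> (\<lambda>n. blinfun_apply (s n) (u r)) \<longlonglongrightarrow> blinfun_apply f (u r)"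
  shows "limitin (weak_star_dual_ball smul) s f sequentially"
proof -
  have "\<And>j. convergent (\<lambda>n. blinfun_apply (s n) (e j))"
    "\<And>r. r \<in> \<Gamma> \<Longrightarrow> convergent (\<lambda>n. blinfun_apply (s n) (u r))"
    using e u by (blast intro: convergentI)+
  then obtain g where g: "limitin (weak_star_dual_ball smul) s g sequentially"
    using dual_ball_pointwise_convergent[of s] s by blast
  then have g_lim: "(\<lambda>n. blinfun_apply (s n) x) \<longlonglongrightarrow> blinfun_apply g x" and "g \<in> K" for x
    by (auto simp: limitin_weak_star_dual_ball)
  have "x \<in> {x. blinfun_apply f x = blinfun_apply g x}" for x
  proof (rule total)
    show "closed {x. blinfun_apply f x = blinfun_apply g x}"
      by (intro closed_Collect_eq linear_continuous_on blinfun.bounded_linear_right)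
  qed (use f \<open>g \<in> K\<close> LIMSEQ_unique[OF e g_lim] LIMSEQ_unique[OF u g_lim] in
      \<open>auto simp: blinfun.add_right dual_ball_def\<close>)
  then have "f = g"
    by (intro blinfun_eqI) simp
  with g show ?thesis
    by simp
qed

subsection \<open>Sequential compactness of the dual ball\<close>

lemma norm_char_seq_le: "norm (char_seq A :: nat \<Rightarrow>\<^sub>C 'k) \<le> 1"
  by (rule norm_bound) (auto simp: apply_char_seq indicator_def)

lemma norm_e_le: "norm (e j) \<le> 1"
  by (simp add: e_def norm_J_c0 char_seq_finite_in_c0_space norm_char_seq_le)

lemma norm_u_le:
  assumes "r \<in> \<Gamma>"
  shows "norm (u r) \<le> 1"
proof -
  have "(0 :: nat \<Rightarrow>\<^sub>C 'k) \<in> c0_space"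
    by (rule linf.subspace_0[OF subspace_c0_space])
  then show ?thesis
    using norm_J[of 0 "{r}" "\<lambda>_. 1"] assms by (simp add: u_def norm_char_seq_le)
qed

text \<open>Chebyshev's counting argument; the 4 is the bound from
  \<open>overlap_sum_squares_le\<close>.\<close>

lemma card_large_values_le:
  fixes b :: "'b \<Rightarrow> 'k"
  assumes "(\<Sum>r\<in>R. (norm (b r))\<^sup>2) \<le> 4" and "\<And>r. r \<in> R \<Longrightarrow> \<delta> \<le> norm (b r)" and "\<delta> > 0"
  shows "real (card R) \<le> 4 / \<delta>\<^sup>2"
proof -
  have "real (card R) * \<delta>\<^sup>2 \<le> (\<Sum>r\<in>R. (norm (b r))\<^sup>2)"
    using assms(2,3) by (intro sum_bounded_below power_mono) auto
  then show ?thesis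
    using assms by (simp add: pos_le_divide_eq)
qed

text \<open>Equal values at the \<open>e j\<close> make the corrections on \<open>D\<close> vanish,
  so the squared deviations at any finitely many \<open>u r\<close> sum to at most 4. This bounds
  the finite subsets of each level \<open>B k\<close>, and the levels cover the support.\<close>

lemma countable_support:
  assumes f: "f \<in> K" and g: "g \<in> K" and eq: "\<And>j. blinfun_apply f (e j) = blinfun_apply g (e j)"
  shows "countable {r\<in>\<Gamma>. blinfun_apply f (u r) \<noteq> blinfun_apply g (u r)}"
proof -
  define B where "B k = {r\<in>\<Gamma>. inverse (real (Suc k)) \<le> norm (blinfun_apply (f - g) (u r))}" for k
  have "finite (B k)" for k
  proof -
    have "card R \<le> nat \<lfloor>4 / (inverse (real (Suc k)))\<^sup>2\<rfloor>" if R: "R \<subseteq> B k" "finite R" for R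
    proof -
      have "R \<subseteq> \<Gamma>"
        using R by (auto simp: B_def)
      then obtain D where "(\<Sum>r\<in>R. (norm (blinfun_apply (f - g) (u r) -
          (\<Sum>j\<in>D \<inter> N r. blinfun_apply (f - g) (e j))))\<^sup>2) \<le> 4"
        using overlap_sum_squares_le[OF \<open>finite R\<close> \<open>R \<subseteq> \<Gamma>\<close>] f g by blast
      then have "(\<Sum>r\<in>R. (norm (blinfun_apply (f - g) (u r)))\<^sup>2) \<le> 4"
        by (simp add: blinfun.diff_left eq)
      then have "real (card R) \<le> 4 / (inverse (real (Suc k)))\<^sup>2"
        using R by (intro card_large_values_le) (auto simp: B_def)
      then show ?thesis
        by linarith
    qed
    then show ?thesis
      using finite_if_finite_subsets_card_bdd by blast
  qed
  moreover have "{r\<in>\<Gamma>. blinfun_apply f (u r) \<noteq> blinfun_apply g (u r)} \<subseteq> (\<Union>k. B k)"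
  proof
    fix r assume r: "r \<in> {r\<in>\<Gamma>. blinfun_apply f (u r) \<noteq> blinfun_apply g (u r)}"
    then have "norm (blinfun_apply (f - g) (u r)) > 0"
      by (simp add: blinfun.diff_left)
    then obtain k where "inverse (real (Suc k)) < norm (blinfun_apply (f - g) (u r))"
      using reals_Archimedean by blast
    then show "r \<in> (\<Union>k. B k)"
      using r by (auto simp: B_def intro: less_imp_le)
  qed
  moreover from \<open>\<And>k. finite (B k)\<close> have "countable (\<Union>k. B k)"
    by (intro countable_UN) (auto intro: countable_finite)
  ultimately show ?thesis
    by (blast intro: countable_subset)
qed

text \<open>Compare a late term that is far from \<open>h\<close> at every index in \<open>R\<close>
  with a late term that is near \<open>h\<close> there. The values at the \<open>e j\<close> have
  settled, so their difference stays at least \<open>\<epsilon> / 2\<close> even after correction,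
  and \<open>card_large_values_le\<close> applies.\<close>

lemma card_persistent_deviation_le:
  fixes s :: "nat \<Rightarrow> 'x \<Rightarrow>\<^sub>L 'k" and \<sigma> :: "nat \<Rightarrow> nat"
  assumes s: "\<And>n. s n \<in> K" and conv: "\<And>j. convergent (\<lambda>n. blinfun_apply (s n) (e j))"
    and h: "\<And>R \<delta> m. finite R \<Longrightarrow> \<delta> > 0 \<Longrightarrow>
      \<exists>n\<ge>m. \<forall>r\<in>R. dist (blinfun_apply (s n) (u r)) (h r) < \<delta>"
    and "\<epsilon> > 0" and \<sigma>: "strict_mono \<sigma>" and R: "finite R" "R \<subseteq> \<Gamma>"
    and dev: "\<And>n r. r \<in> R \<Longrightarrow> \<epsilon> \<le> dist (blinfun_apply (s (\<sigma> n)) (u r)) (h r)"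
  shows "real (card R) \<le> 4 / (\<epsilon> / 2)\<^sup>2"
proof -
  obtain D where D: "finite D" "\<And>f g. f \<in> K \<Longrightarrow> g \<in> K \<Longrightarrow>
    (\<Sum>r\<in>R. (norm (blinfun_apply (f - g) (u r) -
      (\<Sum>j\<in>D \<inter> N r. blinfun_apply (f - g) (e j))))\<^sup>2) \<le> 4"
    using overlap_sum_squares_le[OF R] by blast
  \<comment> \<open>\<open>D\<close> was fixed before the terms to be compared, so the corrections
    are finite sums of convergent sequences and hence Cauchy.\<close>
  define c where "c n r = (\<Sum>j\<in>D \<inter> N r. blinfun_apply (s n) (e j))" for n r
  have "eventually (\<lambda>M. \<forall>m\<ge>M. \<forall>n\<ge>M. dist (c m r) (c n r) < \<epsilon> / 4) sequentially" for r
  proof -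
    have "Cauchy (\<lambda>n. c n r)"
      unfolding c_def Cauchy_convergent_iff by (intro convergent_sum conv)
    then obtain M where "\<forall>m\<ge>M. \<forall>n\<ge>M. dist (c m r) (c n r) < \<epsilon> / 4"
      using \<open>\<epsilon> > 0\<close> unfolding Cauchy_def by (metis divide_pos_pos zero_less_numeral)
    then show ?thesis
      by (intro eventually_sequentiallyI[of M]) auto
  qed
  then have "eventually (\<lambda>M. \<forall>r\<in>R. \<forall>m\<ge>M. \<forall>n\<ge>M. dist (c m r) (c n r) < \<epsilon> / 4) sequentially"
    by (intro eventually_ball_finite R) auto
  then obtain M where M: "\<And>r m n. r \<in> R \<Longrightarrow> m \<ge> M \<Longrightarrow> n \<ge> M \<Longrightarrow> dist (c m r) (c n r) < \<epsilon> / 4"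
    unfolding eventually_sequentially by blast
  \<comment> \<open>The near term exists beyond \<open>M\<close> because \<open>h\<close> is a
    cluster point. The far term is number \<open>\<sigma> M\<close>, again at least
    \<open>M\<close>.\<close>
  obtain m where m: "m \<ge> M" "\<And>r. r \<in> R \<Longrightarrow> dist (blinfun_apply (s m) (u r)) (h r) < \<epsilon> / 4"
    using h[OF R(1), of "\<epsilon> / 4" M] \<open>\<epsilon> > 0\<close> by auto
  define n where "n = \<sigma> M"
  have "n \<ge> M"
    unfolding n_def by (rule strict_mono_imp_increasing[OF \<sigma>])
  show ?thesis
  proof (rule card_large_values_le)
    show "(\<Sum>r\<in>R. (norm (blinfun_apply (s n - s m) (u r) -
        (\<Sum>j\<in>D \<inter> N r. blinfun_apply (s n - s m) (e j))))\<^sup>2) \<le> 4"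
      by (intro D(2) s)
    fix r assume r: "r \<in> R"
    have "blinfun_apply (s n - s m) (u r) - (\<Sum>j\<in>D \<inter> N r. blinfun_apply (s n - s m) (e j)) =
        (blinfun_apply (s n) (u r) - h r) -
        ((blinfun_apply (s m) (u r) - h r) + (c n r - c m r))"
      by (simp add: blinfun.diff_left c_def sum_subtractf)
    also have "norm \<dots> \<ge> norm (blinfun_apply (s n) (u r) - h r) -
        (norm (blinfun_apply (s m) (u r) - h r) + norm (c n r - c m r))"
      using norm_triangle_ineq2 norm_triangle_ineq by (smt (verit))
    \<comment> \<open>The near term and the change of the correction each cost less than
      \<open>\<epsilon> / 4\<close>.\<close>
    finally show "\<epsilon> / 2 \<le> norm (blinfun_apply (s n - s m) (u r) -
        (\<Sum>j\<in>D \<inter> N r. blinfun_apply (s n - s m) (e j)))"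
      using dev[OF r, of M] m(2)[OF r] M[OF r \<open>n \<ge> M\<close> m(1)]
      by (simp add: dist_norm n_def)
  qed (use \<open>\<epsilon> > 0\<close> in simp)
qed

text \<open>Take a largest \<open>R\<close> such that some subsequence deviates from
  \<open>h\<close> at every index in \<open>R\<close> at all times;
  \<open>card_persistent_deviation_le\<close> bounds its size. An index outside \<open>R\<close>
  deviating infinitely often would, along a further subsequence, enlarge \<open>R\<close>.\<close>

lemma subseq_close_off_finite:
  fixes s :: "nat \<Rightarrow> 'x \<Rightarrow>\<^sub>L 'k" and \<sigma> :: "nat \<Rightarrow> nat"
  assumes s: "\<And>n. s n \<in> K" and conv: "\<And>j. convergent (\<lambda>n. blinfun_apply (s n) (e j))"
    and h: "\<And>R \<delta> m. finite R \<Longrightarrow> \<delta> > 0 \<Longrightarrow>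
      \<exists>n\<ge>m. \<forall>r\<in>R. dist (blinfun_apply (s n) (u r)) (h r) < \<delta>"
    and "\<epsilon> > 0" and \<sigma>: "strict_mono \<sigma>"
  obtains \<rho> R where "strict_mono \<rho>" "finite R"
    "\<And>r. r \<in> \<Gamma> - R \<Longrightarrow>
      eventually (\<lambda>n. dist (blinfun_apply (s (\<sigma> (\<rho> n))) (u r)) (h r) < \<epsilon>) sequentially"
proof -
  define dev where "dev n r \<longleftrightarrow> \<epsilon> \<le> dist (blinfun_apply (s n) (u r)) (h r)" for n r
  define good where "good R \<longleftrightarrow> finite R \<and> R \<subseteq> \<Gamma> \<and>
    (\<exists>\<rho> :: nat \<Rightarrow> nat. strict_mono \<rho> \<and> (\<forall>n. \<forall>r\<in>R. dev (\<sigma> (\<rho> n)) r))" for R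
  have "card R \<le> nat \<lfloor>4 / (\<epsilon> / 2)\<^sup>2\<rfloor>" if good_R: "good R" for R
  proof -
    obtain \<rho> :: "nat \<Rightarrow> nat" where R: "finite R" "R \<subseteq> \<Gamma>" and \<rho>: "strict_mono \<rho>" "\<forall>n. \<forall>r\<in>R. dev (\<sigma> (\<rho> n)) r"
      using good_R by (auto simp: good_def)
    have "real (card R) \<le> 4 / (\<epsilon> / 2)\<^sup>2"
    proof (rule card_persistent_deviation_le[OF s conv h \<open>\<epsilon> > 0\<close> _ R])
      show "strict_mono (\<lambda>n. \<sigma> (\<rho> n))"
        using strict_mono_o[OF \<sigma> \<rho>(1)] by (simp add: o_def)
    qed (use \<rho>(2) in \<open>auto simp: dev_def\<close>)
    then show ?thesis
      by linarith
  qed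
  then have bound: "\<forall>R. good R \<longrightarrow> card R < Suc (nat \<lfloor>4 / (\<epsilon> / 2)\<^sup>2\<rfloor>)"
    by (simp add: le_imp_less_Suc)
  have "good {}"
    unfolding good_def using strict_mono_id by auto
  from ex_has_greatest_nat[OF this bound] obtain R
    where R: "good R" and max: "\<And>R'. good R' \<Longrightarrow> card R' \<le> card R"
    by blast
  obtain \<rho> :: "nat \<Rightarrow> nat" where \<rho>: "strict_mono \<rho>" "\<forall>n. \<forall>r\<in>R. dev (\<sigma> (\<rho> n)) r"
    using R by (auto simp: good_def)
  have "eventually (\<lambda>n. dist (blinfun_apply (s (\<sigma> (\<rho> n))) (u r)) (h r) < \<epsilon>) sequentially"
    if r: "r \<in> \<Gamma> - R" for r
  proof (rule ccontr)
    assume "\<not> ?thesis"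
    then have "infinite {n. dev (\<sigma> (\<rho> n)) r}"
      by (simp add: dev_def not_less eventually_cofinite flip: cofinite_eq_sequentially)
    then obtain \<tau> :: "nat \<Rightarrow> nat" where \<tau>: "strict_mono \<tau>" "\<And>n. dev (\<sigma> (\<rho> (\<tau> n))) r"
      using infinite_enumerate by blast
    have "good (insert r R)"
      unfolding good_def using R r \<rho> \<tau> strict_mono_o[OF \<rho>(1) \<tau>(1)]
      by (auto simp: good_def intro!: exI[of _ "\<rho> \<circ> \<tau>"])
    then have "card (insert r R) \<le> card R"
      by (rule max)
    then show False
      using R r by (simp add: good_def)
  qed
  then show thesis
    using that \<rho>(1) R by (auto simp: good_def)
qed

text \<open>Three extractions: \<open>\<sigma>\<^sub>0\<close> settles the \<open>e j\<close>; a
  diagonal sequence then converges to \<open>h\<close> at all but countably many \<open>u r\<close>;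
  \<open>\<kappa>\<close> settles the remaining countable set \<open>C\<close>, where the limit need
  not be \<open>h\<close>.\<close>

lemma dual_ball_sequentially_compact:
  fixes s :: "nat \<Rightarrow> 'x \<Rightarrow>\<^sub>L 'k"
  assumes s: "\<And>n. s n \<in> K"
  obtains \<sigma> f where "strict_mono \<sigma>" "limitin (weak_star_dual_ball smul) (s \<circ> \<sigma>) f sequentially"
proof -
  have "norm (blinfun_apply (s n) (e j)) \<le> 1" for n j
    using norm_apply_dual_ball_le[OF s] norm_e_le order_trans by blast
  then obtain \<sigma>\<^sub>0 :: "nat \<Rightarrow> nat" where \<sigma>\<^sub>0: "strict_mono \<sigma>\<^sub>0"
    and lim: "\<And>j. \<exists>l. (\<lambda>n. blinfun_apply (s (\<sigma>\<^sub>0 n)) (e j)) \<longlonglongrightarrow> l"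
    using function_convergent_subsequence[of "UNIV :: nat set" "\<lambda>n j. blinfun_apply (s n) (e j)" 1]
    by (metis UNIV_I uncountable_def countableI_type)
  then have conv: "convergent (\<lambda>n. blinfun_apply (s (\<sigma>\<^sub>0 n)) (e j))" for j
    by (simp add: convergent_def)
  define t where "t n = s (\<sigma>\<^sub>0 n)" for n
  have t: "t n \<in> K" for n
    by (simp add: t_def s)
  have t_bound: "blinfun_apply (t n) (u r) \<in> cball 0 (norm (u r))" for n r
    using norm_apply_dual_ball_le[OF t] by simp
  then obtain h where h: "\<And>R \<delta> m. finite R \<Longrightarrow> \<delta> > 0 \<Longrightarrow>
      \<exists>n\<ge>m. \<forall>r\<in>R. dist (blinfun_apply (t n) (u r)) (h r) < \<delta>"
    using bounded_functions_cluster_point[of "\<lambda>n r. blinfun_apply (t n) (u r)", OF t_bound] by blast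
  \<comment> \<open>A finite exceptional set is allowed for each tolerance
    \<open>1 / (k + 1)\<close>. Subsequences inherit the property, as the diagonal construction
    requires.\<close>
  define P where "P k \<rho> \<longleftrightarrow> (\<exists>R. finite R \<and> (\<forall>r\<in>\<Gamma> - R. eventually (\<lambda>n.
      dist (blinfun_apply (t (\<rho> n)) (u r)) (h r) < inverse (real (Suc k))) sequentially))" for k \<rho>
  interpret diag: subseqs P
  proof
    fix k and \<rho> :: "nat \<Rightarrow> nat" assume "strict_mono \<rho>"
    then obtain \<tau> R where "strict_mono \<tau>" "finite R" "\<And>r. r \<in> \<Gamma> - R \<Longrightarrow> eventually (\<lambda>n.
        dist (blinfun_apply (t (\<rho> (\<tau> n))) (u r)) (h r) < inverse (real (Suc k))) sequentially"
      using subseq_close_off_finite[OF t conv[folded t_def] h, of "inverse (real (Suc k))" \<rho>]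
      by (metis inverse_positive_iff_positive of_nat_0_less_iff zero_less_Suc)
    then show "\<exists>\<tau>. strict_mono \<tau> \<and> P k (\<rho> \<circ> \<tau>)"
      unfolding P_def comp_apply by blast
  qed
  \<comment> \<open>Only from index \<open>Suc k\<close> on is the diagonal sequence guaranteed to
    run inside the extraction made for \<open>P k\<close>, hence the shift.\<close>
  have "P k (diag.diagseq \<circ> (+) (Suc k))" for k
  proof (rule diag.diagseq_holds)
    fix \<tau> \<rho> :: "nat \<Rightarrow> nat" and n assume \<tau>: "strict_mono \<tau>" and "P n \<rho>"
    then obtain R where R: "finite R" "\<forall>r\<in>\<Gamma> - R. eventually (\<lambda>m.
        dist (blinfun_apply (t (\<rho> m)) (u r)) (h r) < inverse (real (Suc n))) sequentially"
      by (auto simp: P_def)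
    show "P n (\<rho> \<circ> \<tau>)"
      unfolding P_def comp_apply
    proof (intro exI conjI ballI)
      fix r assume "r \<in> \<Gamma> - R"
      from eventually_subseq[OF \<tau> bspec[OF R(2) this]]
      show "eventually (\<lambda>m. dist (blinfun_apply (t (\<rho> (\<tau> m))) (u r)) (h r) <
          inverse (real (Suc n))) sequentially" .
    qed (rule R(1))
  qed
  then have "\<forall>k. \<exists>R. finite R \<and> (\<forall>r\<in>\<Gamma> - R. eventually (\<lambda>n.
      dist (blinfun_apply (t (diag.diagseq (Suc k + n))) (u r)) (h r) < inverse (real (Suc k))) sequentially)"
    unfolding P_def comp_apply by blast
  from choice[OF this] obtain R where R: "\<And>k. finite (R k)"
    "\<And>k r. r \<in> \<Gamma> - R k \<Longrightarrow> eventually (\<lambda>n.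
      dist (blinfun_apply (t (diag.diagseq (Suc k + n))) (u r)) (h r) < inverse (real (Suc k))) sequentially"
    by blast
  define C where "C = \<Gamma> \<inter> (\<Union>k. R k)"
  have "countable C"
    unfolding C_def using R(1) by (intro countable_Int2 countable_UN) (auto intro: countable_finite)
  moreover have "norm (blinfun_apply (t (diag.diagseq n)) (u r)) \<le> 1" if "r \<in> C" for n r
    using norm_apply_dual_ball_le[OF t] norm_u_le that order_trans unfolding C_def by blast
  ultimately obtain \<kappa> :: "nat \<Rightarrow> nat" where \<kappa>: "strict_mono \<kappa>" and
    conv_C: "\<And>r. r \<in> C \<Longrightarrow> \<exists>l. (\<lambda>n. blinfun_apply (t (diag.diagseq (\<kappa> n))) (u r)) \<longlonglongrightarrow> l"
    using function_convergent_subsequence[of C "\<lambda>n r. blinfun_apply (t (diag.diagseq n)) (u r)" 1]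
    by blast
  \<comment> \<open>Outside \<open>C\<close> no tolerance has an exception, so the bounds for all
    \<open>k\<close> give convergence to \<open>h\<close>.\<close>
  have off_C: "(\<lambda>n. blinfun_apply (t (diag.diagseq n)) (u r)) \<longlonglongrightarrow> h r" if "r \<in> \<Gamma> - C" for r
  proof (rule tendstoI)
    fix \<epsilon> :: real assume "\<epsilon> > 0"
    then obtain k where k: "inverse (real (Suc k)) < \<epsilon>"
      using reals_Archimedean by blast
    have "eventually (\<lambda>n. dist (blinfun_apply (t (diag.diagseq (n + Suc k))) (u r)) (h r) < \<epsilon>) sequentially"
      using R(2)[of r k] that k by (auto simp: C_def add.commute elim!: eventually_mono)
    then show "eventually (\<lambda>n. dist (blinfun_apply (t (diag.diagseq n)) (u r)) (h r) < \<epsilon>) sequentially"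
      by (subst (asm) eventually_sequentially_seg)
  qed
  define \<sigma> where "\<sigma> = diag.diagseq \<circ> \<kappa>"
  have \<sigma>: "strict_mono \<sigma>"
    unfolding \<sigma>_def by (intro strict_mono_o diag.subseq_diagseq \<kappa>)
  have "convergent (\<lambda>n. blinfun_apply (t (\<sigma> n)) (e j))" for j
    using convergent_subseq_convergent[OF conv[of j] \<sigma>] by (simp add: o_def t_def)
  moreover have "convergent (\<lambda>n. blinfun_apply (t (\<sigma> n)) (u r))" if "r \<in> \<Gamma>" for r
  proof (cases "r \<in> C")
    case True
    then show ?thesis
      using conv_C by (auto simp: convergent_def \<sigma>_def)
  next
    case False
    then show ?thesis
      using LIMSEQ_subseq_LIMSEQ[OF off_C \<kappa>, of r] that by (auto simp: convergent_def \<sigma>_def o_def)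
  qed
  ultimately obtain f where "limitin (weak_star_dual_ball smul) (\<lambda>n. t (\<sigma> n)) f sequentially"
    using dual_ball_pointwise_convergent[of "\<lambda>n. t (\<sigma> n)"] t by blast
  then have "limitin (weak_star_dual_ball smul) (s \<circ> (\<sigma>\<^sub>0 \<circ> \<sigma>)) f sequentially"
    by (simp add: t_def o_def)
  then show thesis
    using that strict_mono_o[OF \<sigma>\<^sub>0 \<sigma>] by blast
qed

subsection \<open>Two sequential closures suffice\<close>

text \<open>Approximate \<open>f\<close> within \<open>1 / (n + 1)\<close> on growing finite sets of
  the prescribed vectors. The approximants converge to \<open>f\<close> at those vectors, and
  sequential compactness gives a subsequence with a weak-star limit \<open>g\<close>.\<close>

lemma seq_closure_agreeing_on_countable:
  assumes F: "F \<subseteq> K" and f: "f \<in> weak_star_dual_ball smul closure_of F"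
    and C: "countable C" "C \<subseteq> \<Gamma>"
  obtains g where "g \<in> seq_closure_of (weak_star_dual_ball smul) F"
    "\<And>j. blinfun_apply g (e j) = blinfun_apply f (e j)"
    "\<And>r. r \<in> C \<Longrightarrow> blinfun_apply g (u r) = blinfun_apply f (u r)"
proof -
  \<comment> \<open>If \<open>C\<close> is empty, \<open>from_nat_into C\<close> has an unspecified
    value; this only prescribes agreement at one further vector.\<close>
  define X where "X n = e ` {..n} \<union> (\<lambda>i. u (from_nat_into C i)) ` {..n}" for n :: nat
  have "\<exists>g. g \<in> F \<and> (\<forall>x\<in>X n. dist (blinfun_apply g x) (blinfun_apply f x) < inverse (real (Suc n)))"
    for n
    using weak_star_closure_approx[OF f, of "X n" "inverse (real (Suc n))"]
    by (metis X_def finite_Un finite_atMost finite_imageI inverse_positive_iff_positive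
        of_nat_0_less_iff zero_less_Suc)
  then obtain s where s: "\<And>n. s n \<in> F"
    and s_near: "\<And>n x. x \<in> X n \<Longrightarrow> dist (blinfun_apply (s n) x) (blinfun_apply f x) < inverse (real (Suc n))"
    by metis
  have lim_X: "(\<lambda>n. blinfun_apply (s n) x) \<longlonglongrightarrow> blinfun_apply f x" if x: "x \<in> X m" for x m
  proof (rule metric_tendsto_imp_tendsto[OF LIMSEQ_inverse_real_of_nat])
    have "eventually (\<lambda>n. x \<in> X n) sequentially"
      using x by (intro eventually_sequentiallyI[of m]) (force simp: X_def)
    then show "eventually (\<lambda>n. dist (blinfun_apply (s n) x) (blinfun_apply f x) \<le>
        dist (inverse (real (Suc n))) 0) sequentially"
      by eventually_elim (use s_near in \<open>force intro: less_imp_le\<close>)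
  qed
  obtain \<sigma> g where \<sigma>: "strict_mono \<sigma>"
    and g: "limitin (weak_star_dual_ball smul) (s \<circ> \<sigma>) g sequentially"
    using dual_ball_sequentially_compact[of s] s F by blast
  have g_eq: "blinfun_apply g x = blinfun_apply f x" if "x \<in> X m" for x m
    using g LIMSEQ_subseq_LIMSEQ[OF lim_X[OF that] \<sigma>]
    by (auto simp: limitin_weak_star_dual_ball o_def intro: LIMSEQ_unique)
  show thesis
  proof (rule that)
    show "g \<in> seq_closure_of (weak_star_dual_ball smul) F"
      using g s unfolding seq_closure_of_def limitin_def by (auto intro!: exI[of _ "s \<circ> \<sigma>"] simp: g)
    show "blinfun_apply g (e j) = blinfun_apply f (e j)" for j
      by (rule g_eq[of _ j]) (simp add: X_def)
    show "blinfun_apply g (u r) = blinfun_apply f (u r)" if r: "r \<in> C" for r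
    proof -
      obtain m where "from_nat_into C m = r"
        using from_nat_into_surj[OF C(1) r] by blast
      then show ?thesis
        by (intro g_eq[of _ m]) (auto simp: X_def)
    qed
  qed
qed

text \<open>The chosen terms have pairwise disjoint supports relative to \<open>f\<close>, so at
  each \<open>u r\<close> the sequence takes at most one wrong value.\<close>

lemma closure_of_subset_seq_closure_iter_2:
  assumes F: "F \<subseteq> K"
  shows "weak_star_dual_ball smul closure_of F \<subseteq> seq_closure_iter (weak_star_dual_ball smul) 2 F"
proof
  fix f assume f: "f \<in> weak_star_dual_ball smul closure_of F"
  then have "f \<in> K"
    by (simp add: in_closure_of topspace_weak_star_dual_ball)
  define G where "G = {g \<in> seq_closure_of (weak_star_dual_ball smul) F.
    \<forall>j. blinfun_apply g (e j) = blinfun_apply f (e j)}"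
  have G_K: "g \<in> K" if "g \<in> G" for g
    using that by (simp add: G_def seq_closure_of_def topspace_weak_star_dual_ball)
  define supp where "supp g = {r\<in>\<Gamma>. blinfun_apply g (u r) \<noteq> blinfun_apply f (u r)}" for g :: "'x \<Rightarrow>\<^sub>L 'k"
  have countable_supp: "countable (supp g)" if "g \<in> G" for g
    unfolding supp_def using that G_K \<open>f \<in> K\<close> by (intro countable_support) (auto simp: G_def)
  \<comment> \<open>Each choice must respect all earlier ones, hence the choice principle along the
    well-order of \<open>nat\<close>; the union of the earlier supports is countable.\<close>
  have "\<exists>s :: nat \<Rightarrow> 'x \<Rightarrow>\<^sub>L 'k. \<forall>n. s n \<in> G \<and> (\<forall>m<n. \<forall>r\<in>supp (s m). blinfun_apply (s n) (u r) = blinfun_apply f (u r))"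
  proof (rule dependent_wellorder_choice)
    fix s :: "nat \<Rightarrow> 'x \<Rightarrow>\<^sub>L 'k" and n
    assume "\<And>m. m < n \<Longrightarrow> s m \<in> G \<and>
      (\<forall>i<m. \<forall>r\<in>supp (s i). blinfun_apply (s m) (u r) = blinfun_apply f (u r))"
    then have "countable (\<Union>m<n. supp (s m))"
      by (intro countable_UN countable_supp) auto
    moreover have "(\<Union>m<n. supp (s m)) \<subseteq> \<Gamma>"
      by (auto simp: supp_def)
    ultimately obtain g where "g \<in> seq_closure_of (weak_star_dual_ball smul) F"
      "\<And>j. blinfun_apply g (e j) = blinfun_apply f (e j)"
      "\<And>r. r \<in> (\<Union>m<n. supp (s m)) \<Longrightarrow> blinfun_apply g (u r) = blinfun_apply f (u r)"
      using seq_closure_agreeing_on_countable[OF F f] by metis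
    then show "\<exists>g. g \<in> G \<and> (\<forall>m<n. \<forall>r\<in>supp (s m). blinfun_apply g (u r) = blinfun_apply f (u r))"
      by (auto simp: G_def)
  qed auto
  then obtain s :: "nat \<Rightarrow> 'x \<Rightarrow>\<^sub>L 'k" where s: "\<And>n. s n \<in> G"
    and agree: "\<And>m n r. m < n \<Longrightarrow> r \<in> supp (s m) \<Longrightarrow> blinfun_apply (s n) (u r) = blinfun_apply f (u r)"
    by blast
  have "limitin (weak_star_dual_ball smul) s f sequentially"
  proof (rule dual_ball_limitin)
    fix j
    show "(\<lambda>n. blinfun_apply (s n) (e j)) \<longlonglongrightarrow> blinfun_apply f (e j)"
      using s by (simp add: G_def)
  next
    fix r assume r: "r \<in> \<Gamma>"
    have "eventually (\<lambda>n. blinfun_apply (s n) (u r) = blinfun_apply f (u r)) sequentially"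
    proof (cases "\<exists>m. r \<in> supp (s m)")
      case True
      then obtain m where "r \<in> supp (s m)" ..
      then show ?thesis
        by (intro eventually_sequentiallyI[of "Suc m"] agree[of m]) auto
    next
      case False
      then show ?thesis
        using r by (simp add: supp_def)
    qed
    then show "(\<lambda>n. blinfun_apply (s n) (u r)) \<longlonglongrightarrow> blinfun_apply f (u r)"
      by (rule tendsto_eventually)
  qed (use s G_K \<open>f \<in> K\<close> in auto)
  then show "f \<in> seq_closure_iter (weak_star_dual_ball smul) 2 F"
    using s by (intro seq_closure_iter_2I[of s]) (auto simp: G_def)
qed

subsection \<open>The coordinate functionals\<close>

text \<open>The \<open>n\<close>-th coordinate is 1-Lipschitz on the dense image of
  \<open>JLs\<close>, since the supremum norm is at most the norm after \<open>J\<close>. It extends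
  with the same constant and inherits linearity by continuity.\<close>

lemma coordinate_functional:
  "\<exists>g\<in>K. \<forall>f\<in>JLs. blinfun_apply g (J f) = apply_bcontfun f n"
proof -
  \<comment> \<open>Outside the image of \<open>JLs\<close> the values of \<open>p\<close> are
    unspecified; only the restriction to the image is extended to \<open>q\<close>.\<close>
  define p where "p x = apply_bcontfun (inv_into JLs J x) n" for x
  have J_inj: "inj_on J JLs"
  proof (rule inj_onI)
    fix f g assume "f \<in> JLs" "g \<in> JLs" "J f = J g"
    then show "f = g"
      using norm_le_norm_J[of "f - g"] linf.subspace_diff[OF subspace_span] by (simp add: J_diff)
  qed
  have p: "p (J f) = apply_bcontfun f n" if "f \<in> JLs" for f
    using that J_inj by (simp add: p_def)
  have "1-lipschitz_on (J ` JLs) p"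
  proof (rule lipschitz_onI)
    fix x y assume "x \<in> J ` JLs" "y \<in> J ` JLs"
    then obtain f g where fg: "f \<in> JLs" "g \<in> JLs" "x = J f" "y = J g" by blast
    have "dist (p x) (p y) = norm (apply_bcontfun (f - g) n)"
      using fg by (simp add: p dist_norm minus_bcontfun.rep_eq)
    also have "\<dots> \<le> norm (f - g)"
      by (rule norm_bounded)
    also have "\<dots> \<le> norm (J (f - g))"
      using fg linf.subspace_diff[OF subspace_span] by (intro norm_le_norm_J) auto
    finally show "dist (p x) (p y) \<le> 1 * dist x y"
      using fg by (simp add: J_diff dist_norm)
  qed simp
  then obtain q where q: "1-lipschitz_on UNIV q" and qJ: "\<And>f. f \<in> JLs \<Longrightarrow> q (J f) = apply_bcontfun f n"
    using lipschitz_extend_closure[of 1 "J ` JLs" p] JL2 p unfolding is_JL2_def by auto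
  have q_lim: "(\<lambda>k. q (v k)) \<longlonglongrightarrow> q x" if "v \<longlonglongrightarrow> x" for v x
    using lipschitz_on_continuous_on[OF q] that continuous_on_tendsto_compose[of UNIV q v x sequentially]
    by simp
  have approx: "\<exists>v. (\<forall>k. v k \<in> JLs) \<and> (\<lambda>k. J (v k)) \<longlonglongrightarrow> x" for x
  proof -
    have "x \<in> closure (J ` JLs)"
      using JL2 by (simp add: is_JL2_def)
    then obtain w where w: "\<And>k. w k \<in> J ` JLs" "w \<longlonglongrightarrow> x"
      unfolding closure_sequential by blast
    then have "\<exists>v. v \<in> JLs \<and> w k = J v" for k
      by blast
    then obtain v where "\<And>k. v k \<in> JLs" "\<And>k. w k = J (v k)"
      by metis
    with w(2) show ?thesis
      by (intro exI[of _ v]) (simp add: \<open>\<And>k. w k = J (v k)\<close>[symmetric])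
  qed
  have q_add: "q (x + y) = q x + q y" for x y
  proof -
    obtain v w where v: "\<And>k. v k \<in> JLs" "(\<lambda>k. J (v k)) \<longlonglongrightarrow> x"
      and w: "\<And>k. w k \<in> JLs" "(\<lambda>k. J (w k)) \<longlonglongrightarrow> y"
      using approx[of x] approx[of y] by blast
    have eq: "q (J (v k) + J (w k)) = q (J (v k)) + q (J (w k))" for k
      using v(1)[of k] w(1)[of k] linf.subspace_add[OF subspace_span, of "v k" "w k"]
      by (simp flip: J_add add: qJ plus_bcontfun.rep_eq)
    have "(\<lambda>k. q (J (v k) + J (w k))) \<longlonglongrightarrow> q (x + y)"
      by (intro q_lim tendsto_add v w)
    moreover have "(\<lambda>k. q (J (v k) + J (w k))) \<longlonglongrightarrow> q x + q y"
      unfolding eq by (intro q_lim tendsto_add v w)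
    ultimately show ?thesis
      by (rule LIMSEQ_unique)
  qed
  have q_smul: "q (smul c x) = c * q x" for c x
  proof -
    obtain v where v: "\<And>k. v k \<in> JLs" "(\<lambda>k. J (v k)) \<longlonglongrightarrow> x"
      using approx[of x] by blast
    have "(\<lambda>k. smul c (J (v k))) \<longlonglongrightarrow> smul c x"
    proof (rule Lim_null_comparison[THEN LIM_zero_cancel])
      show "eventually (\<lambda>k. norm (smul c (J (v k)) - smul c x) \<le> norm c * norm (J (v k) - x)) sequentially"
        by (simp add: norm_smul flip: scale_right_diff_distrib)
      show "(\<lambda>k. norm c * norm (J (v k) - x)) \<longlonglongrightarrow> 0"
        using tendsto_norm_zero[OF LIM_zero[OF v(2)]] by (rule tendsto_mult_right_zero)
    qed
    then have "(\<lambda>k. q (smul c (J (v k)))) \<longlonglongrightarrow> q (smul c x)"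
      by (rule q_lim)
    moreover have "q (smul c (J (v k))) = c * q (J (v k))" for k
      using v(1)[of k] linf.subspace_scale[OF subspace_span, of "v k" c]
      by (simp flip: J_scale add: qJ apply_scale_linf)
    ultimately have "(\<lambda>k. c * q (J (v k))) \<longlonglongrightarrow> q (smul c x)"
      by simp
    moreover have "(\<lambda>k. c * q (J (v k))) \<longlonglongrightarrow> c * q x"
      by (intro tendsto_mult_left q_lim v)
    ultimately show ?thesis
      by (rule LIMSEQ_unique)
  qed
  have "q 0 = 0"
    using q_add[of 0 0] by simp
  then have q_le: "norm (q x) \<le> norm x" for x
    using lipschitz_onD[OF q, of x 0] by simp
  have "bounded_linear q"
  proof (rule bounded_linear_intro[of _ 1])
    fix t :: real and x
    show "q (t *\<^sub>R x) = t *\<^sub>R q x"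
      using q_smul[of "of_real t" x] by (simp add: smul_of_real scaleR_conv_of_real)
  qed (simp_all add: q_add q_le)
  then have Blinfun_q: "blinfun_apply (Blinfun q) = q"
    by (rule bounded_linear_Blinfun_apply)
  have "norm (Blinfun q) \<le> 1"
    by (rule norm_blinfun_bound) (simp_all add: Blinfun_q q_le)
  then have "Blinfun q \<in> K"
    by (simp add: dual_ball_def Blinfun_q q_smul)
  then show ?thesis
    by (intro bexI[of _ "Blinfun q"]) (simp_all add: Blinfun_q qJ)
qed

section \<open>The zero functional as an iterated limit of coordinates\<close>

lemma zero_in_dual_ball: "0 \<in> K"
  by (simp add: dual_ball_def)

text \<open>Follow the coordinates along the enumeration \<open>p\<close> of \<open>N r\<close>. It
  leaves every finite set, in particular \<open>{j}\<close> and, by almost disjointness, its overlap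
  with any other \<open>N s\<close>; so the values are eventually constant.\<close>

lemma limit_along_member:
  assumes \<delta>: "\<And>n. \<delta> n \<in> K"
    and \<delta>_J: "\<And>n f. f \<in> JLs \<Longrightarrow> blinfun_apply (\<delta> n) (J f) = apply_bcontfun f n"
    and r: "r \<in> \<Gamma>"
  obtains h where "h \<in> seq_closure_of (weak_star_dual_ball smul) (range \<delta>)"
    "\<And>j. blinfun_apply h (e j) = 0"
    "\<And>s. s \<in> \<Gamma> \<Longrightarrow> blinfun_apply h (u s) = (if s = r then 1 else 0)"
proof -
  define p where "p = enumerate (N r)"
  have "infinite (N r)"
    using ad r by (auto simp: almost_disjoint_def)
  then have p_mono: "strict_mono p" and p_in: "\<And>k. p k \<in> N r"
    by (auto simp: p_def strict_mono_enumerate enumerate_in_set)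
  have avoid: "eventually (\<lambda>k. p k \<notin> A) sequentially" if "finite A" for A
    using that eventually_subseq[OF p_mono, of "\<lambda>n. n \<notin> A"]
    by (simp add: eventually_cofinite flip: cofinite_eq_sequentially)
  have e_lim: "(\<lambda>k. blinfun_apply (\<delta> (p k)) (e j)) \<longlonglongrightarrow> 0" for j
  proof (rule tendsto_eventually)
    show "eventually (\<lambda>k. blinfun_apply (\<delta> (p k)) (e j) = 0) sequentially"
      using avoid[of "{j}"]
      by (simp add: e_def \<delta>_J char_seq_finite_in_span apply_char_seq indicator_def)
  qed
  have u_lim: "(\<lambda>k. blinfun_apply (\<delta> (p k)) (u s)) \<longlonglongrightarrow> (if s = r then 1 else 0)" if s: "s \<in> \<Gamma>" for s
  proof (rule tendsto_eventually)
    have "eventually (\<lambda>k. s = r \<or> p k \<notin> N s) sequentially"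
    proof (cases "s = r")
      case False
      then have "finite (N r \<inter> N s)"
        using ad inj r s unfolding almost_disjoint_def inj_on_def by (metis imageI)
      from avoid[OF this] show ?thesis
        using p_in by (auto elim: eventually_mono)
    qed simp
    then show "eventually (\<lambda>k. blinfun_apply (\<delta> (p k)) (u s) = (if s = r then 1 else 0)) sequentially"
      by eventually_elim
        (use p_in s in \<open>auto simp: u_def \<delta>_J char_seq_N_in_span apply_char_seq indicator_def\<close>)
  qed
  obtain h where h: "limitin (weak_star_dual_ball smul) (\<lambda>k. \<delta> (p k)) h sequentially"
    using dual_ball_pointwise_convergent[of "\<lambda>k. \<delta> (p k)"] \<delta> convergentI[OF e_lim] convergentI[OF u_lim]
    by blast
  then have h_lim: "(\<lambda>k. blinfun_apply (\<delta> (p k)) x) \<longlonglongrightarrow> blinfun_apply h x" for x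
    by (simp add: limitin_weak_star_dual_ball)
  show thesis
  proof (rule that)
    show "h \<in> seq_closure_of (weak_star_dual_ball smul) (range \<delta>)"
      using h limitin_topspace[OF h] by (auto simp: seq_closure_of_def intro!: exI[of _ "\<lambda>k. \<delta> (p k)"])
    show "blinfun_apply h (e j) = 0" for j
      using LIMSEQ_unique[OF h_lim e_lim] .
    show "blinfun_apply h (u s) = (if s = r then 1 else 0)" if "s \<in> \<Gamma>" for s
      using LIMSEQ_unique[OF h_lim u_lim[OF that]] .
  qed
qed

text \<open>The limits \<open>h k\<close> along distinct members \<open>N (\<rho> k)\<close> vanish
  at all \<open>e j\<close>, and at a given \<open>u r\<close> at most one of them is
  nonzero.\<close>

lemma zero_in_seq_closure_iter_2:
  assumes \<delta>: "\<And>n. \<delta> n \<in> K"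
    and \<delta>_J: "\<And>n f. f \<in> JLs \<Longrightarrow> blinfun_apply (\<delta> n) (J f) = apply_bcontfun f n"
    and "infinite \<Gamma>"
  shows "0 \<in> seq_closure_iter (weak_star_dual_ball smul) 2 (range \<delta>)"
proof -
  obtain \<rho> :: "nat \<Rightarrow> 'i" where \<rho>: "inj \<rho>" "range \<rho> \<subseteq> \<Gamma>"
    using infinite_countable_subset[OF \<open>infinite \<Gamma>\<close>] by blast
  have "\<exists>h. h \<in> seq_closure_of (weak_star_dual_ball smul) (range \<delta>) \<and>
      (\<forall>j. blinfun_apply h (e j) = 0) \<and>
      (\<forall>s\<in>\<Gamma>. blinfun_apply h (u s) = (if s = \<rho> k then 1 else 0))" for k
    using limit_along_member[of \<delta> "\<rho> k"] \<delta> \<delta>_J \<rho>(2) by (metis rangeI subsetD)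
  then obtain h where h: "\<And>k. h k \<in> seq_closure_of (weak_star_dual_ball smul) (range \<delta>)"
    and h_e: "\<And>k j. blinfun_apply (h k) (e j) = 0"
    and h_u: "\<And>k s. s \<in> \<Gamma> \<Longrightarrow> blinfun_apply (h k) (u s) = (if s = \<rho> k then 1 else 0)"
    by metis
  have "limitin (weak_star_dual_ball smul) h 0 sequentially"
  proof (rule dual_ball_limitin)
    fix r assume r: "r \<in> \<Gamma>"
    have "finite {k. \<rho> k = r}"
      using \<rho>(1) finite_vimageI[of "{r}" \<rho>] by (simp add: vimage_def)
    then have "eventually (\<lambda>k. \<rho> k \<noteq> r) sequentially"
      by (simp add: eventually_cofinite flip: cofinite_eq_sequentially)
    then have "eventually (\<lambda>k. blinfun_apply (h k) (u r) = blinfun_apply 0 (u r)) sequentially"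
      by eventually_elim (use h_u[OF r] in auto)
    then show "(\<lambda>k. blinfun_apply (h k) (u r)) \<longlonglongrightarrow> blinfun_apply 0 (u r)"
      by (rule tendsto_eventually)
  next
    show "h k \<in> K" for k
      using h by (simp add: seq_closure_of_def topspace_weak_star_dual_ball)
  qed (simp_all add: h_e zero_in_dual_ball)
  then show ?thesis
    by (rule seq_closure_iter_2I[OF h])
qed

text \<open>Suppose the \<open>\<delta> (n k)\<close> tend to 0. Testing at \<open>e j\<close> shows
  that \<open>n\<close> takes each value finitely often, so its range is infinite. Maximality gives
  some \<open>N r\<close> meeting the range in an infinite set, and then the value at
  \<open>u r\<close> is 1 infinitely often.\<close>

lemma zero_notin_seq_closure:
  assumes \<delta>_J: "\<And>n f. f \<in> JLs \<Longrightarrow> blinfun_apply (\<delta> n) (J f) = apply_bcontfun f n"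
    and mad: "maximal_almost_disjoint (N ` \<Gamma>)"
  shows "0 \<notin> seq_closure_of (weak_star_dual_ball smul) (range \<delta>)"
proof
  assume "0 \<in> seq_closure_of (weak_star_dual_ball smul) (range \<delta>)"
  then obtain s where s: "\<And>k. s k \<in> range \<delta>" "limitin (weak_star_dual_ball smul) s 0 sequentially"
    by (auto simp: seq_closure_of_def)
  then have "\<forall>k. \<exists>n. s k = \<delta> n"
    by auto
  then obtain n where n: "\<And>k. s k = \<delta> (n k)"
    by metis
  have lim: "(\<lambda>k. blinfun_apply (\<delta> (n k)) x) \<longlonglongrightarrow> 0" for x
    using s(2) by (simp add: limitin_weak_star_dual_ball n)
  have fin: "finite {k. blinfun_apply (\<delta> (n k)) x = 1}" for x
  proof -
    have "eventually (\<lambda>k. norm (blinfun_apply (\<delta> (n k)) x) < 1) sequentially"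
      using tendsto_norm_zero[OF lim] by (rule order_tendstoD) simp
    then have "eventually (\<lambda>k. blinfun_apply (\<delta> (n k)) x \<noteq> 1) sequentially"
      by eventually_elim auto
    then show ?thesis
      by (simp add: eventually_cofinite flip: cofinite_eq_sequentially)
  qed
  have "finite {k. n k = j}" for j
    using fin[of "e j"]
    by (rule rev_finite_subset)
      (auto simp: e_def \<delta>_J char_seq_finite_in_span apply_char_seq)
  then have "infinite (range n)"
    using pigeonhole_infinite[of "UNIV :: nat set" n] by auto
  \<comment> \<open>Either the range is itself some \<open>N r\<close>, or by maximality adjoining
    it destroys almost disjointness.\<close>
  have "\<exists>r\<in>\<Gamma>. infinite (range n \<inter> N r)"
  proof (cases "range n \<in> N ` \<Gamma>")
    case True
    then obtain r where "r \<in> \<Gamma>" "range n = N r" by blast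
    then show ?thesis
      using \<open>infinite (range n)\<close> by (intro bexI[of _ r]) auto
  next
    case False
    then have "\<not> almost_disjoint (insert (range n) (N ` \<Gamma>))"
      using mad unfolding maximal_almost_disjoint_def by blast
    then show ?thesis
      using ad \<open>infinite (range n)\<close> by (auto simp: almost_disjoint_def Int_commute)
  qed
  then obtain r where r: "r \<in> \<Gamma>" "infinite (range n \<inter> N r)" by blast
  have "finite {k. n k \<in> N r}"
    using fin[of "u r"]
    by (rule rev_finite_subset) (auto simp: u_def \<delta>_J char_seq_N_in_span r apply_char_seq)
  then have "finite (n ` {k. n k \<in> N r})"
    by simp
  moreover have "range n \<inter> N r \<subseteq> n ` {k. n k \<in> N r}"
    by auto
  ultimately show False
    using r(2) finite_subset by blast
qed

text \<open>The set of coordinate functionals witnesses the failure of stages 0 and 1 alike: its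
  closure contains 0, and neither stage does.\<close>

lemma weak_star_sequential_order_2:
  assumes "infinite \<Gamma>" "maximal_almost_disjoint (N ` \<Gamma>)"
  shows "weak_star_sequential_dual_ball_of_order smul 2"
proof -
  have closure: "seq_closure_iter (weak_star_dual_ball smul) 2 F = weak_star_dual_ball smul closure_of F"
    if "F \<subseteq> K" for F
    using closure_of_subset_seq_closure_iter_2[OF that] that
      seq_closure_iter_subset_closure_of[of F "weak_star_dual_ball smul" 2]
    by (simp add: topspace_weak_star_dual_ball subset_antisym)
  obtain \<delta> where \<delta>: "\<And>n. \<delta> n \<in> K"
    and \<delta>_J: "\<And>n f. f \<in> JLs \<Longrightarrow> blinfun_apply (\<delta> n) (J f) = apply_bcontfun f n"
    using coordinate_functional by metis
  have range_K: "range \<delta> \<subseteq> K"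
    using \<delta> by auto
  have zero_cl: "0 \<in> weak_star_dual_ball smul closure_of range \<delta>"
    using zero_in_seq_closure_iter_2[of \<delta>] \<delta> \<delta>_J assms(1) closure[OF range_K] by simp
  have zero_0: "0 \<notin> range \<delta>"
  proof
    assume "0 \<in> range \<delta>"
    then obtain n where "\<delta> n = 0" by auto
    \<comment> \<open>The \<open>n\<close>-th coordinate functional has value 1 at
      \<open>e n\<close>.\<close>
    then show False
      using \<delta>_J[of "char_seq {n}" n] by (simp add: char_seq_finite_in_span apply_char_seq)
  qed
  have zero_1: "0 \<notin> seq_closure_of (weak_star_dual_ball smul) (range \<delta>)"
    using \<delta>_J assms(2) by (rule zero_notin_seq_closure)
  have not_closure: "seq_closure_iter (weak_star_dual_ball smul) m (range \<delta>) \<noteq>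
      weak_star_dual_ball smul closure_of range \<delta>" if "m < 2" for m
  proof
    assume eq: "seq_closure_iter (weak_star_dual_ball smul) m (range \<delta>) =
      weak_star_dual_ball smul closure_of range \<delta>"
    have "0 \<notin> seq_closure_iter (weak_star_dual_ball smul) m (range \<delta>)"
      using less_2_cases[OF that] zero_0 zero_1 by (elim disjE) simp_all
    then show False
      unfolding eq using zero_cl by (rule notE)
  qed
  have "has_sequential_order (weak_star_dual_ball smul) 2"
    unfolding has_sequential_order_def topspace_weak_star_dual_ball
    by (intro conjI allI impI closure exI[of _ "range \<delta>"] range_K not_closure)
  moreover have "sequential_space (weak_star_dual_ball smul)"
    using closure
    by (intro sequential_space_if_seq_closure_iter_2) (simp add: topspace_weak_star_dual_ball)
  ultimately show ?thesis
    by (simp add: weak_star_sequential_dual_ball_of_order_def)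
qed

end

theorem theorem9:
  fixes N :: "'i \<Rightarrow> nat set" and \<Gamma> :: "'i set"
    and smul :: "'k::{real_normed_field,heine_borel} \<Rightarrow> 'x::banach \<Rightarrow> 'x"
    and J :: "(nat \<Rightarrow>\<^sub>C 'k) \<Rightarrow> 'x"
  assumes "inj_on N \<Gamma>"
    and "uncountable \<Gamma>"
    and "maximal_almost_disjoint (N ` \<Gamma>)"
    and "is_JL2 N \<Gamma> smul J"
  shows "weak_star_sequential_dual_ball_of_order smul 2"
proof -
  interpret JL_completion N \<Gamma> smul J
    using assms by unfold_locales (simp_all add: maximal_almost_disjoint_def)
  show ?thesis
    using assms(2,3) by (intro weak_star_sequential_order_2) (auto intro: countable_finite)
qed

end
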